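(* Let $R$ be the Rado graph and $d$ its intrinsic (graph) metric on the vertex set. Then $$s_+(R,d)=s_-(R,d)=+\infty,$$ and $s_\pm(K_\mu)=s_\pm(T_\mu)=+\infty$ for every probability measure $\mu$ on $R$ having full support. Moreover, for every such $\mu$, the only functions in $L^2(R,\mu)$ belonging to the kernel of $T_\mu$ are the constants.
   Context: The Rado graph $R$ is the unique (up to graph isomorphism) countably infinite simple graph with the following extension property: for any two finite disjoint sets $U,V$ of vertices there is a vertex $x\notin U\cup V$ adjacent to all points of $U$ and to no point of $V$. Its intrinsic metric $d$ is the shortest-path distance on vertices; it is bounded by $2$. A probability measure $\mu$ on $R$ has full support if $\mu(\{v\})>0$ for every vertex $v$. For a real symmetric matrix or a compact self-adjoint operator $A$ on a Hilbert space, $s_+(A)$ and $s_-(A)$ denote the numbers (possibly $+\infty$) of strictly positive, respectively strictly negative, eigenvalues of $A$, counted with multiplicity. For a finite subset $X_N=\{x_1,\dots,x_N\}$ of a metric space $(X,d)$, $S(X_N):=\left(-\tfrac12 d^2(x_i,x_j)\right)_{i,j=1}^N$, and $$s_\pm(X,d):=\sup\{s_\pm(S(X_N)) : X_N\subset X \text{ finite}\}.$$ The self-adjoint Hilbert–Schmidt operators $K_\mu,T_\mu$ on $L^2(R,\mu)$ are $$(K_\mu u)(x):=-\frac12\int_R d^2(x,y)u(y)\,d\mu(y),\qquad T_\mu:=P_\mu K_\mu P_\mu,$$ where $P_\mu$ is the orthogonal projector of $L^2(R,\mu)$ onto the orthogonal complement of the constant function $\mathbf 1$. *)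

theory Defs
  imports "HOL-Probability.Probability" "Jordan_Normal_Form.Char_Poly"
begin

section \<open>The Rado graph and its shortest-path metric\<close>

text \<open>The vertex set is the whole type \<open>'a\<close>.\<close>

definition rado_graph :: "('a \<Rightarrow> 'a \<Rightarrow> bool) \<Rightarrow> bool" where
  "rado_graph E \<longleftrightarrow>
     countable (UNIV :: 'a set) \<and> infinite (UNIV :: 'a set) \<and> symp E \<and> irreflp E \<and>
     (\<forall>U V. finite U \<and> finite V \<and> U \<inter> V = {} \<longrightarrow>
        (\<exists>x. x \<notin> U \<union> V \<and> (\<forall>u\<in>U. E x u) \<and> (\<forall>v\<in>V. \<not> E x v)))"

text \<open>\<open>(E ^^ n) x y\<close> says that there is a walk with \<open>n\<close> edges from \<open>x\<close> to \<open>y\<close>; a walk of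
  minimal length is a path. The value is meaningful only if \<open>x\<close> and \<open>y\<close> are connected, which
  always holds in the Rado graph.\<close>

definition graph_dist :: "('a \<Rightarrow> 'a \<Rightarrow> bool) \<Rightarrow> 'a \<Rightarrow> 'a \<Rightarrow> real" where
  "graph_dist E x y = real (LEAST n. (E ^^ n) x y)"


section \<open>Signature of a metric space\<close>

text \<open>\<open>proots\<close> is the multiset of roots with multiplicity. For a real symmetric matrix all
  complex roots of the characteristic polynomial are real, so no eigenvalue is lost here.\<close>

definition s_plus_mat :: "real mat \<Rightarrow> nat" where
  "s_plus_mat A = size {# l \<in># proots (char_poly A). l > 0 #}"

definition s_minus_mat :: "real mat \<Rightarrow> nat" where
  "s_minus_mat A = size {# l \<in># proots (char_poly A). l < 0 #}"

definition S_mat :: "('a \<Rightarrow> 'a \<Rightarrow> real) \<Rightarrow> 'a list \<Rightarrow> real mat" where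
  "S_mat d xs = mat (length xs) (length xs) (\<lambda>(i, j). - (1/2) * (d (xs ! i) (xs ! j))\<^sup>2)"

text \<open>A finite subset is given by an enumeration without repetitions.\<close>

definition s_plus :: "'a set \<Rightarrow> ('a \<Rightarrow> 'a \<Rightarrow> real) \<Rightarrow> enat" where
  "s_plus X d = (SUP xs \<in> {xs. distinct xs \<and> set xs \<subseteq> X}. enat (s_plus_mat (S_mat d xs)))"

definition s_minus :: "'a set \<Rightarrow> ('a \<Rightarrow> 'a \<Rightarrow> real) \<Rightarrow> enat" where
  "s_minus X d = (SUP xs \<in> {xs. distinct xs \<and> set xs \<subseteq> X}. enat (s_minus_mat (S_mat d xs)))"


section \<open>Operators on \<open>L\<^sup>2\<close> and their eigenvalue counts\<close>

text \<open>Elements of the real Hilbert space \<open>L\<^sup>2(M)\<close> are represented by square-integrable functions;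
  equality, and hence linear independence, is understood almost everywhere.\<close>

definition L2 :: "'a measure \<Rightarrow> ('a \<Rightarrow> real) set" where
  "L2 M = {u. u \<in> borel_measurable M \<and> integrable M (\<lambda>x. (u x)\<^sup>2)}"

definition L2_independent :: "'a measure \<Rightarrow> ('a \<Rightarrow> real) set \<Rightarrow> bool" where
  "L2_independent M B \<longleftrightarrow>
     (\<forall>c. (AE x in M. (\<Sum>u\<in>B. c u * u x) = 0) \<longrightarrow> (\<forall>u\<in>B. c u = 0))"

definition L2_dim :: "'a measure \<Rightarrow> ('a \<Rightarrow> real) set \<Rightarrow> enat" where
  "L2_dim M V = (SUP B \<in> {B. finite B \<and> B \<subseteq> V \<and> L2_independent M B}. enat (card B))"

definition eigenspace ::
  "'a measure \<Rightarrow> (('a \<Rightarrow> real) \<Rightarrow> ('a \<Rightarrow> real)) \<Rightarrow> real \<Rightarrow> ('a \<Rightarrow> real) set" where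
  "eigenspace M A l = {u \<in> L2 M. AE x in M. A u x = l * u x}"

text \<open>The supremum over finite \<open>F\<close> is the sum over all \<open>l > 0\<close> (resp. \<open>l < 0\<close>) of the
  multiplicities; numbers that are not eigenvalues contribute \<open>0\<close>.\<close>

definition s_plus_op :: "'a measure \<Rightarrow> (('a \<Rightarrow> real) \<Rightarrow> ('a \<Rightarrow> real)) \<Rightarrow> enat" where
  "s_plus_op M A = (SUP F \<in> {F. finite F \<and> F \<subseteq> {0<..}}. \<Sum>l\<in>F. L2_dim M (eigenspace M A l))"

definition s_minus_op :: "'a measure \<Rightarrow> (('a \<Rightarrow> real) \<Rightarrow> ('a \<Rightarrow> real)) \<Rightarrow> enat" where
  "s_minus_op M A = (SUP F \<in> {F. finite F \<and> F \<subseteq> {..<0}}. \<Sum>l\<in>F. L2_dim M (eigenspace M A l))"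

definition L2_kernel ::
  "'a measure \<Rightarrow> (('a \<Rightarrow> real) \<Rightarrow> ('a \<Rightarrow> real)) \<Rightarrow> ('a \<Rightarrow> real) set" where
  "L2_kernel M A = {u \<in> L2 M. AE x in M. A u x = 0}"

definition K_op :: "('a \<Rightarrow> 'a \<Rightarrow> real) \<Rightarrow> 'a measure \<Rightarrow> ('a \<Rightarrow> real) \<Rightarrow> 'a \<Rightarrow> real" where
  "K_op d M u x = - (1/2) * (\<integral>y. (d x y)\<^sup>2 * u y \<partial>M)"

text \<open>For a probability measure, the constant function \<open>1\<close> is a unit vector, so subtracting the
  mean is the orthogonal projection onto its orthogonal complement (see the lemma below).\<close>

definition P_op :: "'a measure \<Rightarrow> ('a \<Rightarrow> real) \<Rightarrow> 'a \<Rightarrow> real" where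
  "P_op M u x = u x - (\<integral>y. u y \<partial>M)"

definition T_op :: "('a \<Rightarrow> 'a \<Rightarrow> real) \<Rightarrow> 'a measure \<Rightarrow> ('a \<Rightarrow> real) \<Rightarrow> 'a \<Rightarrow> real" where
  "T_op d M u = P_op M (K_op d M (P_op M u))"

lemma P_op_orthogonal_projection:
  assumes "prob_space M" "u \<in> L2 M"
  shows "P_op M u \<in> L2 M"
    and "(\<integral>x. P_op M u x * 1 \<partial>M) = 0"
    and "\<And>v. v \<in> L2 M \<Longrightarrow> (\<integral>x. v x * 1 \<partial>M) = 0 \<Longrightarrow> (\<integral>x. (u x - P_op M u x) * v x \<partial>M) = 0"
proof -
  interpret prob_space M by fact
  have m: "u \<in> borel_measurable M" and sq: "integrable M (\<lambda>x. (u x)\<^sup>2)"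
    using assms(2) by (auto simp: L2_def)
  have i: "integrable M u"
    using square_integrable_imp_integrable[OF m sq] by simp
  have "integrable M (\<lambda>x. (u x)\<^sup>2 - 2 * expectation u * u x + (expectation u)\<^sup>2)"
    using i sq by (intro Bochner_Integration.integrable_add Bochner_Integration.integrable_diff) auto
  also have "(\<lambda>x. (u x)\<^sup>2 - 2 * expectation u * u x + (expectation u)\<^sup>2) = (\<lambda>x. (P_op M u x)\<^sup>2)"
    by (auto simp: P_op_def power2_eq_square algebra_simps)
  finally show "P_op M u \<in> L2 M"
    using m by (auto simp: L2_def P_op_def[abs_def])
  show "(\<integral>x. P_op M u x * 1 \<partial>M) = 0"
    using i by (simp add: P_op_def prob_space)
  show "(\<integral>x. (u x - P_op M u x) * v x \<partial>M) = 0" if "v \<in> L2 M" "(\<integral>x. v x * 1 \<partial>M) = 0" for v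
    using that by (simp add: P_op_def)
qed

end

theory Submission
  imports Defs "HOL-Complex_Analysis.Great_Picard"
begin

text \<open>Every finite graph is an induced subgraph of the Rado graph. On the vertices of \<open>n\<close> disjoint,
  mutually non-adjacent 4-cycles, the functions that alternate in sign along the cycles, with an
  arbitrary amplitude on each cycle, have sum zero and are eigenvectors of the matrix \<open>S\<close> with
  eigenvalue \<open>-1\<close>. On \<open>4n\<close> independent vertices the same functions have eigenvalue \<open>2\<close>. Hence both
  eigenvalues occur with multiplicity at least \<open>n\<close>. Divided by the weights of \<open>\<mu>\<close>, these functions
  span \<open>n\<close>-dimensional spaces of mean-zero functions on which the quadratic forms of \<open>K\<close> and \<open>T\<close>
  agree and are definite; since both operators are compact and symmetric, successive minimisation
  of the form on the orthogonal complement of the eigenvectors already found produces \<open>n\<close>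
  orthonormal eigenvectors of the required sign.

  If \<open>T u = 0\<close>, let \<open>w\<close> be the projection of \<open>u\<close>. Then \<open>4 \<mu>({x}) w(x)\<close> plus three times the integral
  of \<open>w\<close> over the neighbours of \<open>x\<close> does not depend on \<open>x\<close>. By the extension property the neighbours
  of \<open>x\<close> inside a large finite set can be prescribed, while \<open>x\<close> itself lies outside that set, so
  this constant is three times the integral of \<open>w\<close> over any finite set \<open>U\<close>; taking \<open>U\<close> empty and \<open>U\<close>
  a singleton gives \<open>w = 0\<close>.\<close>


section \<open>Square-integrable functions on a countable probability space\<close>

text \<open>Every subset is measurable and every point has positive mass, so the empty set is the
  only null set. Almost-everywhere statements become pointwise ones, and elements of
  \<open>L2 M\<close> are honest functions.\<close>

locale full_support = prob_space M for M :: "'a measure" +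
  assumes sets_M: "sets M = UNIV"
    and measure_pos: "measure M {v} > 0"
    and countable_univ: "countable (UNIV :: 'a set)"
begin

definition ip :: "('a \<Rightarrow> real) \<Rightarrow> ('a \<Rightarrow> real) \<Rightarrow> real" where
  "ip u v = (\<integral>x. u x * v x \<partial>M)"

lemma space_M: "space M = UNIV"
  using sets_M by (metis UNIV_I sets.sets_into_space top.extremum_uniqueI)

lemma measurable_M [simp]: "f \<in> measurable M N \<longleftrightarrow> range f \<subseteq> space N"
  by (auto simp: measurable_def space_M sets_M)

lemma AE_iff_all: "(AE x in M. P x) \<longleftrightarrow> (\<forall>x. P x)"
proof
  assume "AE x in M. P x"
  then obtain N where N: "{x. \<not> P x} \<subseteq> N" "emeasure M N = 0"
    by (auto elim!: AE_E simp: space_M)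
  show "\<forall>x. P x"
  proof (intro allI, rule ccontr)
    fix x assume "\<not> P x"
    then have "emeasure M {x} \<le> emeasure M N"
      using N by (intro emeasure_mono) (auto simp: sets_M)
    then show False
      using N measure_pos[of x] by (simp add: measure_def)
  qed
qed auto

lemma L2_iff: "u \<in> L2 M \<longleftrightarrow> integrable M (\<lambda>x. (u x)\<^sup>2)"
  by (simp add: L2_def)

lemma integrable_mult_L2:
  assumes "u \<in> L2 M" "v \<in> L2 M"
  shows "integrable M (\<lambda>x. u x * v x)"
proof (rule Bochner_Integration.integrable_bound)
  show "integrable M (\<lambda>x. (u x)\<^sup>2 + (v x)\<^sup>2)"
    using assms by (auto simp: L2_iff)
  have "\<bar>u x * v x\<bar> \<le> (u x)\<^sup>2 + (v x)\<^sup>2" for x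
  proof -
    have "2 * \<bar>u x * v x\<bar> \<le> (u x)\<^sup>2 + (v x)\<^sup>2"
      using sum_squares_bound[of "\<bar>u x\<bar>" "\<bar>v x\<bar>"] by (simp add: abs_mult)
    then show ?thesis by linarith
  qed
  then show "AE x in M. norm (u x * v x) \<le> norm ((u x)\<^sup>2 + (v x)\<^sup>2)"
    by (intro AE_I2) simp
qed auto

lemma L2_add: "u \<in> L2 M \<Longrightarrow> v \<in> L2 M \<Longrightarrow> (\<lambda>x. u x + v x) \<in> L2 M"
  using integrable_mult_L2[of u v] by (auto simp: L2_iff power2_sum mult.assoc)

lemma L2_scale: "u \<in> L2 M \<Longrightarrow> (\<lambda>x. c * u x) \<in> L2 M"
  by (auto simp: L2_iff power_mult_distrib)

lemma L2_diff: "u \<in> L2 M \<Longrightarrow> v \<in> L2 M \<Longrightarrow> (\<lambda>x. u x - v x) \<in> L2 M"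
  using L2_add[of u "\<lambda>x. -1 * v x"] L2_scale[of v "-1"] by simp

lemma L2_bounded:
  assumes "\<And>x. \<bar>u x\<bar> \<le> C"
  shows "u \<in> L2 M"
  unfolding L2_iff
  by (rule integrable_const_bound[where B = "C\<^sup>2"])
     (auto intro!: AE_I2 simp: abs_le_square_iff [symmetric] intro: order.trans[OF assms])

lemma L2_const [simp]: "(\<lambda>x. c) \<in> L2 M"
  by (rule L2_bounded[where C = "\<bar>c\<bar>"]) simp

lemma L2_sum:
  assumes "\<And>i. i \<in> I \<Longrightarrow> f i \<in> L2 M"
  shows "(\<lambda>x. \<Sum>i\<in>I. f i x) \<in> L2 M"
  using assms by (induction I rule: infinite_finite_induct) (auto intro: L2_add)

lemma L2_integrable: "u \<in> L2 M \<Longrightarrow> integrable M u"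
  using integrable_mult_L2[of u "\<lambda>_. 1"] by simp

section \<open>The inner product of square-integrable functions\<close>

lemma ip_commute: "ip u v = ip v u"
  by (simp add: ip_def mult.commute)

lemma ip_add_left: "u \<in> L2 M \<Longrightarrow> v \<in> L2 M \<Longrightarrow> w \<in> L2 M \<Longrightarrow>
    ip (\<lambda>x. u x + v x) w = ip u w + ip v w"
  by (simp add: ip_def integrable_mult_L2 ring_distribs)

lemma ip_diff_left: "u \<in> L2 M \<Longrightarrow> v \<in> L2 M \<Longrightarrow> w \<in> L2 M \<Longrightarrow>
    ip (\<lambda>x. u x - v x) w = ip u w - ip v w"
  by (simp add: ip_def integrable_mult_L2 ring_distribs)

lemma ip_scale_left: "ip (\<lambda>x. c * u x) w = c * ip u w"
  by (simp add: ip_def mult.assoc)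

lemma ip_add_right: "u \<in> L2 M \<Longrightarrow> v \<in> L2 M \<Longrightarrow> w \<in> L2 M \<Longrightarrow>
    ip w (\<lambda>x. u x + v x) = ip w u + ip w v"
  by (simp add: ip_def integrable_mult_L2 ring_distribs)

lemma ip_diff_right: "u \<in> L2 M \<Longrightarrow> v \<in> L2 M \<Longrightarrow> w \<in> L2 M \<Longrightarrow>
    ip w (\<lambda>x. u x - v x) = ip w u - ip w v"
  by (simp add: ip_def integrable_mult_L2 ring_distribs)

lemma ip_scale_right: "ip w (\<lambda>x. c * u x) = c * ip w u"
  by (simp add: ip_def mult.left_commute)

lemma ip_sum_left:
  assumes "\<And>i. i \<in> I \<Longrightarrow> f i \<in> L2 M" "w \<in> L2 M"
  shows "ip (\<lambda>x. \<Sum>i\<in>I. f i x) w = (\<Sum>i\<in>I. ip (f i) w)"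
  using assms
proof (induction I rule: infinite_finite_induct)
  case (insert i I)
  then show ?case by (simp add: ip_add_left L2_sum)
qed (auto simp: ip_def)

lemma ip_self_nonneg [simp]: "ip u u \<ge> 0"
  by (simp add: ip_def)

lemma ip_self_eq_0_iff: "u \<in> L2 M \<Longrightarrow> ip u u = 0 \<longleftrightarrow> u = (\<lambda>_. 0)"
  unfolding ip_def
  by (subst integral_nonneg_eq_0_iff_AE) (auto simp: AE_iff_all integrable_mult_L2)

text \<open>A weighted AM-GM bound is all of the Cauchy-Schwarz inequality that is needed here.\<close>

lemma ip_bound:
  assumes "u \<in> L2 M" "v \<in> L2 M" "t > 0"
  shows "\<bar>ip u v\<bar> \<le> t * ip u u + ip v v / t"
proof -
  have *: "\<bar>u x * v x\<bar> \<le> t * (u x)\<^sup>2 + (v x)\<^sup>2 / t" for x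
  proof -
    have "2 * (sqrt t * \<bar>u x\<bar>) * (\<bar>v x\<bar> / sqrt t) \<le> (sqrt t * \<bar>u x\<bar>)\<^sup>2 + (\<bar>v x\<bar> / sqrt t)\<^sup>2"
      by (rule sum_squares_bound)
    then have "2 * \<bar>u x * v x\<bar> \<le> t * (u x)\<^sup>2 + (v x)\<^sup>2 / t"
      using \<open>t > 0\<close> by (simp add: power_mult_distrib power_divide abs_mult)
    then show ?thesis by simp
  qed
  have "\<bar>ip u v\<bar> \<le> (\<integral>x. \<bar>u x * v x\<bar> \<partial>M)"
    unfolding ip_def by (rule integral_abs_bound)
  also have "\<dots> \<le> (\<integral>x. t * (u x)\<^sup>2 + (v x)\<^sup>2 / t \<partial>M)"
    using assms * by (intro integral_mono) (auto simp: integrable_mult_L2 L2_iff)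
  also have "\<dots> = t * ip u u + ip v v / t"
    using assms by (simp add: ip_def L2_iff power2_eq_square)
  finally show ?thesis .
qed

lemma integral_finite_support:
  fixes f :: "'a \<Rightarrow> real"
  assumes "finite F" "\<And>x. x \<notin> F \<Longrightarrow> f x = 0"
  shows "integrable M f" "(\<integral>x. f x \<partial>M) = (\<Sum>a\<in>F. measure M {a} * f a)"
proof -
  have f: "f = (\<lambda>x. \<Sum>a\<in>F. f a * indicator {a} x)"
  proof
    fix x
    show "f x = (\<Sum>a\<in>F. f a * indicator {a} x)"
      using assms by (cases "x \<in> F") (auto simp: indicator_def if_distrib cong: if_cong)
  qed
  have 1: "integrable M (\<lambda>x. f a * indicator {a} x)" for a
    by (rule L2_integrable, rule L2_bounded[where C = "\<bar>f a\<bar>"]) (simp add: indicator_def)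
  show "integrable M f"
    by (subst f) (intro Bochner_Integration.integrable_sum 1)
  have "(\<integral>x. f x \<partial>M) = (\<integral>x. (\<Sum>a\<in>F. f a * indicator {a} x) \<partial>M)"
    by (subst f) simp
  also have "\<dots> = (\<Sum>a\<in>F. measure M {a} * f a)"
    by (subst Bochner_Integration.integral_sum[OF 1]) (simp add: space_M mult.commute)
  finally show "(\<integral>x. f x \<partial>M) = (\<Sum>a\<in>F. measure M {a} * f a)" .
qed

lemma L2_finite_support:
  assumes "finite F" "\<And>x. x \<notin> F \<Longrightarrow> f x = 0"
  shows "f \<in> L2 M"
  unfolding L2_iff using assms by (intro integral_finite_support(1)) auto

section \<open>Limits and subsequences of norm-bounded sequences\<close>

text \<open>Fatou's lemma applied to the squares: closed balls of the Hilbert space are closed under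
  pointwise limits.\<close>

lemma Fatou_L2:
  assumes "\<And>n. U n \<in> L2 M" "\<And>n. ip (U n) (U n) \<le> C" "\<And>x. (\<lambda>n. U n x) \<longlonglongrightarrow> u x"
  shows "u \<in> L2 M" "ip u u \<le> C"
proof -
  have C: "C \<ge> 0" using assms(2)[of 0] ip_self_nonneg[of "U 0"] by linarith
  have "(\<integral>\<^sup>+x. ennreal ((u x)\<^sup>2) \<partial>M) = (\<integral>\<^sup>+x. liminf (\<lambda>n. ennreal ((U n x)\<^sup>2)) \<partial>M)"
  proof (rule nn_integral_cong)
    fix x
    have "(\<lambda>n. ennreal ((U n x)\<^sup>2)) \<longlonglongrightarrow> ennreal ((u x)\<^sup>2)"
      by (intro tendsto_ennrealI tendsto_power assms)
    then show "ennreal ((u x)\<^sup>2) = liminf (\<lambda>n. ennreal ((U n x)\<^sup>2))"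
      by (intro lim_imp_Liminf[symmetric]) auto
  qed
  also have "\<dots> \<le> liminf (\<lambda>n. \<integral>\<^sup>+x. ennreal ((U n x)\<^sup>2) \<partial>M)"
    by (rule nn_integral_liminf) simp
  also have "\<dots> \<le> liminf (\<lambda>n. ennreal C)"
  proof (intro Liminf_mono always_eventually allI)
    fix n
    have "(\<integral>\<^sup>+x. ennreal ((U n x)\<^sup>2) \<partial>M) = ennreal (ip (U n) (U n))"
      using assms(1)[of n] by (subst nn_integral_eq_integral) (auto simp: L2_iff ip_def power2_eq_square)
    then show "(\<integral>\<^sup>+x. ennreal ((U n x)\<^sup>2) \<partial>M) \<le> ennreal C"
      using assms(2)[of n] by (simp add: ennreal_leI)
  qed
  also have "\<dots> = ennreal C" by (simp add: Liminf_const)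
  finally have *: "(\<integral>\<^sup>+x. ennreal ((u x)\<^sup>2) \<partial>M) \<le> ennreal C" .
  show u: "u \<in> L2 M"
    unfolding L2_iff
    by (rule integrableI_bounded) (use * in \<open>auto intro: le_less_trans\<close>)
  have "ennreal (ip u u) = (\<integral>\<^sup>+x. ennreal ((u x)\<^sup>2) \<partial>M)"
    using u by (subst nn_integral_eq_integral) (auto simp: L2_iff ip_def power2_eq_square)
  with * have "ennreal (ip u u) \<le> ennreal C" by simp
  then show "ip u u \<le> C" using C by simp
qed

text \<open>Dominated convergence along an enumeration of the vertices. The prescribed set
  \<open>U\<close> is put into every member of the exhaustion.\<close>

lemma finite_tail:
  fixes f :: "'a \<Rightarrow> real"
  assumes f: "integrable M f" and e: "e > 0" and U: "finite U"
  obtains F where "finite F" "U \<subseteq> F" "(\<integral>x. \<bar>f x\<bar> * indicator (- F) x \<partial>M) < e"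
proof -
  define F where "F N = U \<union> from_nat_into (UNIV :: 'a set) ` {..<N}" for N :: nat
  have "(\<lambda>N. \<integral>x. \<bar>f x\<bar> * indicator (- F N) x \<partial>M) \<longlonglongrightarrow> (\<integral>x. 0 \<partial>M)"
  proof (rule integral_dominated_convergence)
    show "integrable M (\<lambda>x. \<bar>f x\<bar>)" using f by simp
    show "AE x in M. (\<lambda>N. \<bar>f x\<bar> * indicator (- F N) x) \<longlonglongrightarrow> 0"
    proof (rule AE_I2)
      fix x :: 'a
      obtain k where k: "x = from_nat_into UNIV k"
        using countable_univ by (metis UNIV_I from_nat_into_surj)
      have "\<bar>f x\<bar> * indicator (- F N) x = 0" if "N > k" for N
        using that k by (auto simp: F_def)
      then have "eventually (\<lambda>N. \<bar>f x\<bar> * indicator (- F N) x = 0) sequentially"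
        by (rule eventually_mono[OF eventually_gt_at_top[of k]])
      then show "(\<lambda>N. \<bar>f x\<bar> * indicator (- F N) x) \<longlonglongrightarrow> 0"
        by (rule tendsto_eventually)
    qed
  qed (auto simp: indicator_def)
  then have "(\<lambda>N. \<integral>x. \<bar>f x\<bar> * indicator (- F N) x \<partial>M) \<longlonglongrightarrow> 0" by simp
  then have "eventually (\<lambda>N. (\<integral>x. \<bar>f x\<bar> * indicator (- F N) x \<partial>M) < e) sequentially"
    by (rule order_tendstoD(2)) (rule e)
  then have "\<exists>N. (\<integral>x. \<bar>f x\<bar> * indicator (- F N) x \<partial>M) < e"
    by (rule eventually_happens'[OF sequentially_bot])
  then obtain N where N: "(\<integral>x. \<bar>f x\<bar> * indicator (- F N) x \<partial>M) < e" ..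
  show ?thesis
    by (rule that[OF _ _ N]) (use U in \<open>auto simp: F_def\<close>)
qed

text \<open>On norm-bounded sequences, pointwise convergence implies weak convergence: \<open>g\<close> is the
  \<open>L\<^sup>2\<close>-limit of its restrictions to finite sets.\<close>

lemma weak_convergence:
  assumes U: "\<And>n. U n \<in> L2 M" "\<And>n. ip (U n) (U n) \<le> C" "\<And>x. (\<lambda>n. U n x) \<longlonglongrightarrow> u x"
    and g: "g \<in> L2 M"
  shows "(\<lambda>n. ip g (U n)) \<longlonglongrightarrow> ip g u"
proof -
  note u = Fatou_L2[OF U]
  have C: "C \<ge> 0" using U(2)[of 0] ip_self_nonneg[of "U 0"] by linarith
  show ?thesis
  proof (rule LIMSEQ_I)
    fix r :: real assume r: "r > 0"
    \<comment> \<open>The weight for \<open>ip_bound\<close>: it makes the norm term at most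
      \<open>C / s \<le> r / 8\<close>, while the choice of \<open>F\<close> below makes the tail
      term at most \<open>r / 4\<close>. Twice \<open>3 * r / 8\<close> plus \<open>r / 4\<close>
      for the finite part gives \<open>r\<close>.\<close>
    define s where "s = 8 * (C + 1) / r"
    have s: "s > 0" using r C by (simp add: s_def)
    obtain F where fin: "finite F" and F: "(\<integral>x. \<bar>(g x)\<^sup>2\<bar> * indicator (- F) x \<partial>M) < r / (4 * s)"
      using finite_tail[of "\<lambda>x. (g x)\<^sup>2" "r / (4 * s)" "{}"] g r s by (auto simp: L2_iff)
    define h where "h x = (if x \<in> F then 0 else g x)" for x
    have h_L2: "h \<in> L2 M"
      unfolding L2_iff
      by (rule Bochner_Integration.integrable_bound[OF g[unfolded L2_iff]]) (auto simp: h_def)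
    have "ip h h = (\<integral>x. \<bar>(g x)\<^sup>2\<bar> * indicator (- F) x \<partial>M)"
      unfolding ip_def by (intro Bochner_Integration.integral_cong) (auto simp: h_def power2_eq_square)
    with F have N: "ip h h < r / (4 * s)" by simp
    have fin_ip: "ip (\<lambda>x. g x - h x) v = (\<Sum>a\<in>F. measure M {a} * (g a * v a))" for v
      unfolding ip_def
      by (subst integral_finite_support(2)[OF fin]) (auto simp: h_def intro!: sum.cong)
    have "(\<lambda>n. ip (\<lambda>x. g x - h x) (U n)) \<longlonglongrightarrow> ip (\<lambda>x. g x - h x) u"
      unfolding fin_ip by (intro tendsto_intros U)
    then obtain n0 where n0: "\<And>n. n \<ge> n0 \<Longrightarrow>
        \<bar>ip (\<lambda>x. g x - h x) (U n) - ip (\<lambda>x. g x - h x) u\<bar> < r / 4"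
      using r LIMSEQ_D[of "\<lambda>n. ip (\<lambda>x. g x - h x) (U n)" _ "r/4"] by auto
    have hb: "\<bar>ip h v\<bar> \<le> 3 * r / 8" if "v \<in> L2 M" "ip v v \<le> C" for v
    proof -
      have "\<bar>ip h v\<bar> \<le> s * ip h h + ip v v / s"
        using that h_L2 s by (intro ip_bound)
      also have "s * ip h h \<le> r / 4" using N s by (simp add: field_simps)
      also have "ip v v / s \<le> C / s" using that s by (simp add: divide_right_mono)
      also have "C / s \<le> r / 8" using C r by (simp add: s_def field_simps)
      finally show ?thesis by simp
    qed
    show "\<exists>n0. \<forall>n\<ge>n0. norm (ip g (U n) - ip g u) < r"
    proof (intro exI allI impI)
      fix n assume "n \<ge> n0"
      have "\<bar>ip g (U n) - ip g u - (ip h (U n) - ip h u)\<bar> < r / 4"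
        using n0[OF \<open>n \<ge> n0\<close>] U(1) u g h_L2 by (simp add: ip_diff_left algebra_simps)
      moreover have "\<bar>ip h (U n)\<bar> \<le> 3 * r / 8" "\<bar>ip h u\<bar> \<le> 3 * r / 8"
        by (rule hb[OF U(1,2)], rule hb[OF u])
      ultimately show "norm (ip g (U n) - ip g u) < r"
        unfolding real_norm_def by linarith
    qed
  qed
qed

lemma pointwise_convergent_subsequence:
  fixes U :: "nat \<Rightarrow> 'a \<Rightarrow> real"
  assumes "\<And>n. U n \<in> L2 M" "\<And>n. ip (U n) (U n) \<le> 1"
  obtains k u where "strict_mono k" "\<And>x. (\<lambda>n. U (k n) x) \<longlonglongrightarrow> u x"
proof -
  \<comment> \<open>On the unit ball \<open>measure M {x} * (U n x)\<^sup>2\<close> is at most 1, so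
    scaling by the square root of the mass bounds all values by 1. A diagonal argument over the
    countable vertex set then applies, and the scaling is undone pointwise.\<close>
  define s where "s x = sqrt (measure M {x})" for x
  have s: "s x > 0" for x using measure_pos by (simp add: s_def)
  have bound: "norm (s x * U n x) \<le> 1" for n x
  proof -
    have "measure M {x} * (U n x)\<^sup>2 = (\<integral>y. (U n y)\<^sup>2 * indicator {x} y \<partial>M)"
      by (subst integral_finite_support(2)[of "{x}"]) auto
    also have "\<dots> \<le> (\<integral>y. (U n y)\<^sup>2 \<partial>M)"
    proof (rule integral_mono)
      show "integrable M (\<lambda>y. (U n y)\<^sup>2 * indicator {x} y)"
        by (rule integral_finite_support(1)[of "{x}"]) auto
    qed (use assms(1)[of n] in \<open>auto simp: L2_iff indicator_def\<close>)
    also have "\<dots> \<le> 1"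
      using assms(2)[of n] by (simp add: ip_def power2_eq_square)
    finally have "(s x * U n x)\<^sup>2 \<le> 1"
      by (simp add: s_def power_mult_distrib)
    then show ?thesis
      by (simp add: abs_square_le_1)
  qed
  obtain k where k: "strict_mono (k :: nat \<Rightarrow> nat)"
      "\<And>x. \<exists>l. (\<lambda>n. s x * U (k n) x) \<longlonglongrightarrow> l"
    using function_convergent_subsequence[OF countable_univ, of "\<lambda>n x. s x * U n x" 1] bound
    by (metis UNIV_I)
  have "\<exists>l. (\<lambda>n. U (k n) x) \<longlonglongrightarrow> l" for x
  proof -
    obtain l where "(\<lambda>n. s x * U (k n) x) \<longlonglongrightarrow> l" using k by blast
    then have "(\<lambda>n. s x * U (k n) x / s x) \<longlonglongrightarrow> l / s x"
      using s[of x] by (intro tendsto_divide) auto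
    then show ?thesis using s[of x] by auto
  qed
  then show ?thesis using that k(1) by metis
qed

end


section \<open>Compact symmetric operators\<close>

lemma infinity_if_all_enat_le:
  assumes "\<And>n. enat n \<le> x"
  shows "x = \<infinity>"
  using assms[of "Suc (the_enat x)"] by (cases x) auto

text \<open>A homogeneous linear system with fewer equations than unknowns, by Gaussian elimination:
  an equation \<open>b\<close> with a nonzero coefficient is used to eliminate an unknown
  \<open>k0\<close>, and the induction hypothesis solves the rest.\<close>

lemma exists_nontrivial_solution:
  fixes f :: "'i \<Rightarrow> 'b \<Rightarrow> real"
  assumes "finite B" "finite K" "card B < card K"
  shows "\<exists>c. (\<exists>k\<in>K. c k \<noteq> 0) \<and> (\<forall>b\<in>B. (\<Sum>k\<in>K. c k * f k b) = 0)"
  using assms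
proof (induction B arbitrary: K f rule: finite_induct)
  case empty
  then have "K \<noteq> {}" by auto
  then show ?case by (intro exI[of _ "\<lambda>_. 1"]) auto
next
  case (insert b B)
  show ?case
  proof (cases "\<forall>k\<in>K. f k b = 0")
    case True
    then show ?thesis
      using insert.IH[of K f] insert.prems insert.hyps by auto
  next
    case False
    then obtain k0 where k0: "k0 \<in> K" "f k0 b \<noteq> 0" by auto
    define K' where "K' = K - {k0}"
    have K: "K = insert k0 K'" "k0 \<notin> K'" "finite K'"
      using k0 insert.prems by (auto simp: K'_def)
    have "card B < card K'"
      using insert.prems insert.hyps K by auto
    then obtain c where c: "\<exists>k\<in>K'. c k \<noteq> 0"
        "\<forall>b'\<in>B. (\<Sum>k\<in>K'. c k * (f k b' - f k b / f k0 b * f k0 b')) = 0"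
      using insert.IH[OF K(3), where f = "\<lambda>k b'. f k b' - f k b / f k0 b * f k0 b'"] by blast
    \<comment> \<open>The value of the eliminated unknown is the one dictated by equation
      \<open>b\<close>.\<close>
    define c' where "c' = c(k0 := - (\<Sum>k\<in>K'. c k * f k b) / f k0 b)"
    have c': "(\<Sum>k\<in>K. c' k * f k b') =
        - (\<Sum>k\<in>K'. c k * f k b) / f k0 b * f k0 b' + (\<Sum>k\<in>K'. c k * f k b')" for b'
    proof -
      have "(\<Sum>k\<in>K'. c' k * f k b') = (\<Sum>k\<in>K'. c k * f k b')"
        using K(2) by (intro sum.cong) (auto simp: c'_def)
      then show ?thesis using K by (simp add: c'_def)
    qed
    show ?thesis
    proof (intro exI conjI ballI)
      show "\<exists>k\<in>K. c' k \<noteq> 0" using c(1) K by (auto simp: c'_def)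
      fix b' assume "b' \<in> insert b B"
      then show "(\<Sum>k\<in>K. c' k * f k b') = 0"
      proof
        assume "b' = b"
        then show ?thesis using k0 by (simp add: c')
      next
        assume "b' \<in> B"
        then have "(\<Sum>k\<in>K'. c k * f k b') - (\<Sum>k\<in>K'. c k * (f k b / f k0 b * f k0 b')) = 0"
          using c(2) by (simp add: sum_subtractf right_diff_distrib)
        also have "(\<Sum>k\<in>K'. c k * (f k b / f k0 b * f k0 b')) =
            (\<Sum>k\<in>K'. c k * f k b) / f k0 b * f k0 b'"
          by (simp add: sum_distrib_right sum_divide_distrib mult.assoc)
        finally show ?thesis by (simp add: c')
      qed
    qed
  qed
qed

section \<open>Orthonormal eigenvectors and eigenvalue counts\<close>

context full_support
begin

definition orthonormal :: "('a \<Rightarrow> real) set \<Rightarrow> bool" where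
  "orthonormal B \<longleftrightarrow> B \<subseteq> L2 M \<and> (\<forall>b\<in>B. \<forall>b'\<in>B. ip b b' = (if b = b' then 1 else 0))"

lemma orthonormal_independent:
  assumes "orthonormal B" "finite B"
  shows "L2_independent M B"
  unfolding L2_independent_def AE_iff_all
proof (intro allI impI ballI)
  fix c :: "('a \<Rightarrow> real) \<Rightarrow> real" and b assume c: "\<forall>x. (\<Sum>u\<in>B. c u * u x) = 0" and b: "b \<in> B"
  have "0 = ip (\<lambda>x. \<Sum>u\<in>B. c u * u x) b"
    using c by (simp add: ip_def)
  also have "\<dots> = (\<Sum>u\<in>B. ip (\<lambda>x. c u * u x) b)"
    using assms b by (intro ip_sum_left) (auto simp: orthonormal_def intro!: L2_scale)
  also have "\<dots> = (\<Sum>u\<in>B. if u = b then c b else 0)"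
    using assms b by (intro sum.cong) (auto simp: orthonormal_def ip_scale_left)
  also have "\<dots> = c b"
    using assms b by simp
  finally show "c b = 0" by simp
qed

text \<open>Grouped by eigenvalue, the vectors form independent families in the respective
  eigenspaces. The finitely many eigenvalues that occur are one of the sets \<open>F\<close> of the
  supremum.\<close>

lemma card_le_sum_L2_dim:
  assumes B: "orthonormal B" "finite B"
    and eig: "\<And>b. b \<in> B \<Longrightarrow> \<exists>l\<in>L. \<forall>x. A b x = l * b x"
  shows "enat (card B) \<le> (SUP F \<in> {F. finite F \<and> F \<subseteq> L}. \<Sum>l\<in>F. L2_dim M (eigenspace M A l))"
proof -
  obtain l where l: "\<And>b. b \<in> B \<Longrightarrow> l b \<in> L" "\<And>b x. b \<in> B \<Longrightarrow> A b x = l b * b x"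
    using eig by metis
  have "enat (card B) = (\<Sum>a\<in>l ` B. enat (card {b\<in>B. l b = a}))"
  proof -
    have "card B = (\<Sum>a\<in>l ` B. card {b\<in>B. l b = a})"
      using sum.image_gen[OF B(2), of "\<lambda>_. 1::nat" l] by simp
    then show ?thesis by (simp flip: of_nat_eq_enat)
  qed
  also have "\<dots> \<le> (\<Sum>a\<in>l ` B. L2_dim M (eigenspace M A a))"
  proof (rule sum_mono)
    fix a assume "a \<in> l ` B"
    define B' where "B' = {b\<in>B. l b = a}"
    have "orthonormal B'" "finite B'"
      using B by (auto simp: orthonormal_def B'_def)
    moreover have "B' \<subseteq> eigenspace M A a"
      using B l by (auto simp: B'_def eigenspace_def orthonormal_def)
    ultimately show "enat (card {b\<in>B. l b = a}) \<le> L2_dim M (eigenspace M A a)"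
      unfolding L2_dim_def B'_def[symmetric]
      by (intro SUP_upper) (auto intro: orthonormal_independent)
  qed
  also have "\<dots> \<le> (SUP F \<in> {F. finite F \<and> F \<subseteq> L}. \<Sum>l\<in>F. L2_dim M (eigenspace M A l))"
    using l B by (intro SUP_upper) auto
  finally show ?thesis .
qed

end

section \<open>Symmetric operators that are compact, and their negative eigenvectors\<close>

text \<open>Compactness is encoded by two conditions suited to integral operators with bounded
  kernel: the unit ball is mapped to uniformly bounded functions, and pointwise convergence within
  the unit ball is preserved. Dominated convergence turns these into norm convergence of the
  images.\<close>

locale compact_symmetric = full_support +
  fixes A :: "('a \<Rightarrow> real) \<Rightarrow> 'a \<Rightarrow> real"
  assumes add: "u \<in> L2 M \<Longrightarrow> v \<in> L2 M \<Longrightarrow> A (\<lambda>x. u x + v x) = (\<lambda>x. A u x + A v x)"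
    and scale: "u \<in> L2 M \<Longrightarrow> A (\<lambda>x. c * u x) = (\<lambda>x. c * A u x)"
    and symmetric: "u \<in> L2 M \<Longrightarrow> v \<in> L2 M \<Longrightarrow> ip u (A v) = ip (A u) v"
    and bounded: "\<exists>C. \<forall>u\<in>L2 M. ip u u \<le> 1 \<longrightarrow> (\<forall>x. \<bar>A u x\<bar> \<le> C)"
    and continuous: "\<lbrakk>\<And>n. U n \<in> L2 M; \<And>n. ip (U n) (U n) \<le> 1; \<And>x. (\<lambda>n. U n x) \<longlonglongrightarrow> u x\<rbrakk>
      \<Longrightarrow> (\<lambda>n. A (U n) x) \<longlonglongrightarrow> A u x"
begin

lemma maps_L2:
  assumes "u \<in> L2 M"
  shows "A u \<in> L2 M"
proof -
  \<comment> \<open>Since \<open>r \<ge> 1\<close> and \<open>ip u u \<le> r \<le> r * r\<close>,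
    division by \<open>r\<close> moves \<open>u\<close> into the unit ball, where the uniform bound
    applies.\<close>
  define r where "r = 1 + ip u u"
  have r: "r \<ge> 1" "ip u u \<le> r" by (auto simp: r_def)
  define v where "v = (\<lambda>x. 1 / r * u x)"
  have v: "v \<in> L2 M" unfolding v_def by (intro L2_scale assms)
  have "ip v v \<le> 1"
  proof -
    have "ip u u \<le> r * r" using r mult_right_mono[of 1 r r] by linarith
    then show ?thesis using r by (simp only: v_def ip_scale_left ip_scale_right) (simp add: field_simps)
  qed
  then obtain C where "\<And>x. \<bar>A v x\<bar> \<le> C" using bounded v by blast
  then have "A v \<in> L2 M" by (rule L2_bounded)
  moreover have "A u = (\<lambda>x. r * A v x)"
    using scale[OF v, of r] r by (simp add: v_def)
  ultimately show ?thesis by (simp add: L2_scale)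
qed

text \<open>The form splits as \<open>ip (U n) (A (U n)) = ip (U n) (D n) + ip (A u) (U n)\<close>.
  The first term vanishes in the limit because the images converge in norm, and the second converges
  weakly. This makes the minimum of the form attainable.\<close>

lemma compact:
  assumes "\<And>n. U n \<in> L2 M" "\<And>n. ip (U n) (U n) \<le> 1" "\<And>x. (\<lambda>n. U n x) \<longlonglongrightarrow> u x"
  shows "(\<lambda>n. ip (U n) (A (U n))) \<longlonglongrightarrow> ip u (A u)"
proof -
  note u = Fatou_L2[OF assms]
  obtain C where C: "\<And>u x. u \<in> L2 M \<Longrightarrow> ip u u \<le> 1 \<Longrightarrow> \<bar>A u x\<bar> \<le> C"
    using bounded by blast
  define D where "D n = (\<lambda>x. A (U n) x - A u x)" for n
  have D: "D n \<in> L2 M" for n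
    unfolding D_def by (intro L2_diff maps_L2 assms u)
  have D_lim: "(\<lambda>n. ip (D n) (D n)) \<longlonglongrightarrow> (\<integral>x. 0 \<partial>M)"
    unfolding ip_def
  proof (rule integral_dominated_convergence[where w = "\<lambda>_. (2 * C)\<^sup>2"])
    show "AE x in M. (\<lambda>n. D n x * D n x) \<longlonglongrightarrow> 0"
    proof (rule AE_I2)
      fix x
      have "(\<lambda>n. A (U n) x) \<longlonglongrightarrow> A u x"
        by (rule continuous) (use assms in auto)
      then have "(\<lambda>n. D n x) \<longlonglongrightarrow> 0" unfolding D_def using LIM_zero by blast
      then have "(\<lambda>n. D n x * D n x) \<longlonglongrightarrow> 0 * 0" by (intro tendsto_mult)
      then show "(\<lambda>n. D n x * D n x) \<longlonglongrightarrow> 0" by simp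
    qed
    show "AE x in M. norm (D n x * D n x) \<le> (2 * C)\<^sup>2" for n
    proof (rule AE_I2)
      fix x
      have "\<bar>A (U n) x\<bar> \<le> C" "\<bar>A u x\<bar> \<le> C" using C assms u by auto
      then have "\<bar>D n x\<bar> \<le> 2 * C" by (simp add: D_def)
      then have "\<bar>D n x\<bar> * \<bar>D n x\<bar> \<le> 2 * C * (2 * C)" by (intro mult_mono) auto
      then show "norm (D n x * D n x) \<le> (2 * C)\<^sup>2" by (simp add: abs_mult power2_eq_square)
    qed
  qed auto
  have "(\<lambda>n. ip (U n) (D n)) \<longlonglongrightarrow> 0"
  proof (rule LIMSEQ_I)
    fix r :: real assume r: "r > 0"
    have "eventually (\<lambda>n. ip (D n) (D n) < r\<^sup>2 / 16) sequentially"
      by (rule order_tendstoD(2)[OF D_lim]) (use r in simp)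
    then obtain n0 where n0: "\<And>n. n \<ge> n0 \<Longrightarrow> ip (D n) (D n) < r\<^sup>2 / 16"
      by (auto simp: eventually_sequentially)
    show "\<exists>n0. \<forall>n\<ge>n0. norm (ip (U n) (D n) - 0) < r"
    proof (intro exI allI impI)
      fix n assume "n \<ge> n0"
      have "\<bar>ip (U n) (D n)\<bar> \<le> r / 4 * ip (U n) (U n) + ip (D n) (D n) / (r / 4)"
        using assms D r by (intro ip_bound) auto
      also have "r / 4 * ip (U n) (U n) \<le> r / 4" using assms(2)[of n] r by simp
      also have "ip (D n) (D n) / (r / 4) < r / 2"
        using n0[OF \<open>n \<ge> n0\<close>] r ip_self_nonneg[of "D n"]
        by (simp add: field_simps power2_eq_square del: ip_self_nonneg)
      finally show "norm (ip (U n) (D n) - 0) < r" using r by simp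
    qed
  qed
  moreover have "(\<lambda>n. ip (A u) (U n)) \<longlonglongrightarrow> ip (A u) u"
    by (rule weak_convergence[OF assms maps_L2[OF u(1)]])
  ultimately have "(\<lambda>n. ip (U n) (D n) + ip (A u) (U n)) \<longlonglongrightarrow> 0 + ip (A u) u"
    by (rule tendsto_add)
  moreover have "ip (U n) (D n) + ip (A u) (U n) = ip (U n) (A (U n))" for n
    unfolding D_def by (subst ip_diff_right) (auto simp: assms maps_L2 u ip_commute)
  ultimately show ?thesis by (simp add: ip_commute)
qed

text \<open>Ensures that the infimum of the form over the unit ball is finite.\<close>

lemma form_bounded: "\<exists>C. \<forall>u\<in>L2 M. ip u u \<le> 1 \<longrightarrow> ip u (A u) \<ge> - C"
proof -
  obtain C where C: "\<And>u x. u \<in> L2 M \<Longrightarrow> ip u u \<le> 1 \<Longrightarrow> \<bar>A u x\<bar> \<le> C"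
    using bounded by blast
  show ?thesis
  proof (intro exI ballI impI)
    fix u assume u: "u \<in> L2 M" "ip u u \<le> 1"
    have "\<bar>ip u (A u)\<bar> \<le> 1 * ip u u + ip (A u) (A u) / 1"
      using u by (intro ip_bound maps_L2) auto
    also have "ip (A u) (A u) \<le> (\<integral>x. C\<^sup>2 \<partial>M)"
      unfolding ip_def
    proof (rule integral_mono)
      fix x
      have "\<bar>A u x\<bar> * \<bar>A u x\<bar> \<le> C * C" using C[OF u, of x] by (intro mult_mono) auto
      then show "A u x * A u x \<le> C\<^sup>2" by (simp add: power2_eq_square)
    qed (auto intro: integrable_mult_L2 maps_L2 u)
    finally show "ip u (A u) \<ge> - (1 + C\<^sup>2)" using u by (simp add: prob_space)
  qed
qed

text \<open>The minimiser of the quadratic form on the unit ball of the orthogonal complement of a set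
  of eigenvectors is again an eigenvector.\<close>

lemma next_eigenvector:
  assumes B: "B \<subseteq> L2 M" "\<And>b. b \<in> B \<Longrightarrow> \<exists>l. \<forall>x. A b x = l * b x"
    and w: "w \<in> L2 M" "\<And>b. b \<in> B \<Longrightarrow> ip w b = 0" "ip w (A w) < 0"
  obtains v l where "v \<in> L2 M" "\<And>b. b \<in> B \<Longrightarrow> ip v b = 0" "ip v v = 1" "l < 0"
    "\<And>x. A v x = l * v x"
proof -
  define V where "V = {u \<in> L2 M. \<forall>b\<in>B. ip u b = 0}"
  have V_scale: "(\<lambda>x. c * u x) \<in> V" if "u \<in> V" for u c
    using that by (auto simp: V_def L2_scale ip_scale_left)
  have V_add: "(\<lambda>x. u x + v x) \<in> V" if "u \<in> V" "v \<in> V" for u v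
    using that B(1) by (auto simp: V_def L2_add) (subst ip_add_left, auto)
  \<comment> \<open>By symmetry, the orthogonal complement of a set of eigenvectors is invariant
    under \<open>A\<close>.\<close>
  have V_A: "A u \<in> V" if "u \<in> V" for u
  proof -
    have "ip (A u) b = 0" if b: "b \<in> B" for b
    proof -
      obtain l where "\<forall>x. A b x = l * b x" using B b by blast
      then have "A b = (\<lambda>x. l * b x)" by auto
      then have "ip u (A b) = l * ip u b" by (simp add: ip_scale_right)
      then show ?thesis using \<open>u \<in> V\<close> b B symmetric[of u b] by (auto simp: V_def)
    qed
    then show ?thesis using \<open>u \<in> V\<close> by (auto simp: V_def maps_L2)
  qed
  define S where "S = {u \<in> V. ip u u \<le> 1}"
  define Q where "Q u = ip u (A u)" for u
  define I where "I = Inf (Q ` S)"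
  have wV: "w \<in> V" using w by (auto simp: V_def)
  have Q_scale: "Q (\<lambda>x. c * u x) = c\<^sup>2 * Q u" if "u \<in> V" for u c
    using that by (simp add: Q_def scale V_def ip_scale_left ip_scale_right power2_eq_square)
  have bdd: "bdd_below (Q ` S)"
  proof -
    obtain C where "\<And>u. u \<in> L2 M \<Longrightarrow> ip u u \<le> 1 \<Longrightarrow> - C \<le> ip u (A u)"
      using form_bounded by blast
    then show ?thesis by (intro bdd_belowI[of _ "- C"]) (auto simp: Q_def S_def V_def)
  qed
  have normalize: "(\<lambda>x. 1 / sqrt (ip u u) * u x) \<in> S"
    "Q (\<lambda>x. 1 / sqrt (ip u u) * u x) = Q u / ip u u"
    if "u \<in> V" "ip u u > 0" for u
  proof -
    define s where "s = sqrt (ip u u)"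
    have s: "s > 0" "ip u u = s * s" using that(2) by (auto simp: s_def)
    have "ip (\<lambda>x. 1 / s * u x) (\<lambda>x. 1 / s * u x) = 1"
      unfolding ip_scale_left ip_scale_right s(2) using s(1) by simp
    then show "(\<lambda>x. 1 / sqrt (ip u u) * u x) \<in> S"
      using V_scale[OF that(1), of "1 / s"] unfolding S_def s_def by auto
    show "Q (\<lambda>x. 1 / sqrt (ip u u) * u x) = Q u / ip u u"
      unfolding Q_scale[OF that(1)] s_def[symmetric] s(2) by (simp add: power2_eq_square)
  qed
  \<comment> \<open>Homogeneity extends the bound from the unit ball to all of
    \<open>V\<close>.\<close>
  have ge: "Q u \<ge> I * ip u u" if "u \<in> V" for u
  proof (cases "ip u u = 0")
    case True
    then have "u = (\<lambda>x. 0)" using that ip_self_eq_0_iff by (auto simp: V_def)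
    then show ?thesis using True by (simp add: Q_def ip_def)
  next
    case False
    then have p: "ip u u > 0" using ip_self_nonneg[of u] by linarith
    then have "I \<le> Q u / ip u u"
      using normalize[OF that p] cInf_lower[OF _ bdd] by (metis I_def imageI)
    then show ?thesis using p by (simp add: field_simps)
  qed
  have wp: "ip w w > 0"
  proof (rule ccontr)
    assume "\<not> ip w w > 0"
    then have "ip w w = 0" using ip_self_nonneg[of w] by linarith
    then have "w = (\<lambda>x. 0)" using w ip_self_eq_0_iff by auto
    then show False using w(3) by (simp add: ip_def)
  qed
  have I: "I < 0"
  proof -
    have "I * ip w w < 0" using ge[OF wV] w(3) by (simp add: Q_def)
    then show ?thesis using wp by (simp add: mult_less_0_iff)
  qed
  have "\<exists>u. u \<in> S \<and> Q u < I + 1 / real (Suc n)" for n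
    using normalize[OF wV wp] bdd cInf_lessD[of "Q ` S" "I + 1 / real (Suc n)"]
    by (auto simp: I_def)
  then obtain U where U: "\<And>n. U n \<in> S" "\<And>n. Q (U n) < I + 1 / real (Suc n)"
    by metis
  have UL: "U n \<in> L2 M" "ip (U n) (U n) \<le> 1" for n
    using U(1)[of n] by (auto simp: S_def V_def)
  obtain k u where k: "strict_mono k" and u: "\<And>x. (\<lambda>n. U (k n) x) \<longlonglongrightarrow> u x"
    by (rule pointwise_convergent_subsequence[of U, OF UL]) (rule that)
  have u_L2: "u \<in> L2 M" and u1: "ip u u \<le> 1"
    using Fatou_L2[of "\<lambda>n. U (k n)", OF UL u] by auto
  \<comment> \<open>Orthogonality to each \<open>b\<close> survives the limit, by weak convergence
    tested against \<open>b\<close>.\<close>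
  have uV: "u \<in> V"
  proof -
    have "ip u b = 0" if b: "b \<in> B" for b
    proof -
      have "(\<lambda>n. ip b (U (k n))) \<longlonglongrightarrow> ip b u"
        by (rule weak_convergence[of "\<lambda>n. U (k n)", OF UL u]) (use B b in auto)
      moreover have "ip b (U (k n)) = 0" for n
        using U(1)[of "k n"] b by (simp add: S_def V_def ip_commute)
      ultimately show ?thesis by (simp add: LIMSEQ_const_iff ip_commute)
    qed
    then show ?thesis using u_L2 by (auto simp: V_def)
  qed
  have "Q u \<le> I"
  proof (rule LIMSEQ_le)
    show "(\<lambda>n. Q (U (k n))) \<longlonglongrightarrow> Q u"
      unfolding Q_def by (rule compact[of "\<lambda>n. U (k n)", OF UL u])
    have "(\<lambda>n. I + 1 / real (Suc n)) \<longlonglongrightarrow> I + 0"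
      by (intro tendsto_add tendsto_const LIMSEQ_Suc lim_1_over_n)
    then show "(\<lambda>n. I + 1 / real (Suc (k n))) \<longlonglongrightarrow> I"
      using LIMSEQ_subseq_LIMSEQ[OF _ k, of "\<lambda>n. I + 1 / real (Suc n)" I] by (simp add: o_def)
    show "\<exists>N. \<forall>n\<ge>N. Q (U (k n)) \<le> I + 1 / real (Suc (k n))"
      using U(2) less_imp_le by blast
  qed
  \<comment> \<open>A pointwise limit may lose norm, but \<open>I < 0\<close> excludes this: the
    chain \<open>I * ip u u \<le> Q u \<le> I \<le> I * ip u u\<close> forces equality throughout,
    hence norm one.\<close>
  moreover have "I \<le> I * ip u u" using u1 I by simp
  ultimately have Qu: "Q u = I * ip u u" and u2: "ip u u = 1"
  proof -
    have "Q u \<ge> I * ip u u" using ge uV by blast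
    with \<open>Q u \<le> I\<close> \<open>I \<le> I * ip u u\<close> have "Q u = I" "I * ip u u = I" by linarith+
    then show "Q u = I * ip u u" "ip u u = 1" using I by auto
  qed
  \<comment> \<open>The residual of the eigenvalue equation. Perturbing the minimiser by
    \<open>t * z\<close> gives a quadratic inequality in \<open>t\<close> whose linear coefficient
    is twice the squared norm of \<open>z\<close>; a nonzero linear coefficient contradicts it for
    small negative \<open>t\<close>.\<close>
  define z where "z = (\<lambda>x. A u x + (- I) * u x)"
  have zV: "z \<in> V" unfolding z_def using uV by (intro V_add V_A V_scale)
  then have z_L2: "z \<in> L2 M" by (simp add: V_def)
  define \<beta> where "\<beta> = ip z (A u) - I * ip z u"
  have \<beta>: "\<beta> = ip z z"
  proof -
    have "ip z (\<lambda>x. A u x + (- I) * u x) = ip z (A u) + ip z (\<lambda>x. (- I) * u x)"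
      using z_L2 u_L2 by (intro ip_add_right maps_L2 L2_scale)
    then show ?thesis
      unfolding \<beta>_def ip_scale_right z_def[symmetric] by simp
  qed
  define \<gamma> where "\<gamma> = Q z - I * ip z z"
  have "0 \<le> 2 * t * \<beta> + t\<^sup>2 * \<gamma>" for t
  proof -
    have tz: "(\<lambda>x. t * z x) \<in> L2 M" using z_L2 by (rule L2_scale)
    have 1: "Q (\<lambda>x. u x + t * z x) = Q u + 2 * t * ip z (A u) + t\<^sup>2 * Q z"
    proof -
      have "ip u (A z) = ip z (A u)" using symmetric[OF u_L2 z_L2] by (simp add: ip_commute)
      then show ?thesis
        unfolding Q_def add[OF u_L2 tz] scale[OF z_L2]
        using u_L2 z_L2 tz maps_L2[OF u_L2] maps_L2[OF z_L2]
        by (simp add: ip_add_left ip_add_right ip_scale_left ip_scale_right L2_scale L2_add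
              power2_eq_square ring_distribs)
    qed
    have 2: "ip (\<lambda>x. u x + t * z x) (\<lambda>x. u x + t * z x) = ip u u + 2 * t * ip z u + t\<^sup>2 * ip z z"
      using u_L2 z_L2 tz ip_commute[of u z]
      by (simp add: ip_add_left ip_add_right ip_scale_left ip_scale_right L2_scale L2_add
            power2_eq_square ring_distribs)
    have "I * ip (\<lambda>x. u x + t * z x) (\<lambda>x. u x + t * z x) \<le> Q (\<lambda>x. u x + t * z x)"
      using uV zV by (intro ge V_add V_scale)
    then show ?thesis
      unfolding 1 2 Qu \<beta>_def \<gamma>_def by (simp add: algebra_simps)
  qed
  note quad = this
  have "\<beta> = 0"
  proof (rule ccontr)
    assume "\<beta> \<noteq> 0"
    then have b: "\<beta> > 0" using \<beta> ip_self_nonneg[of z] by linarith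
    define d where "d = 1 + \<bar>\<gamma>\<bar>"
    have d: "d > 0" "\<gamma> \<le> d" by (auto simp: d_def)
    \<comment> \<open>With \<open>d\<close> positive and at least \<open>\<gamma>\<close>, the
      quadratic term is at most \<open>- t * \<beta>\<close>, so it can absorb only half of the
      negative linear term \<open>2 * t * \<beta>\<close>.\<close>
    define t where "t = - \<beta> / d"
    have "t\<^sup>2 * \<gamma> \<le> t\<^sup>2 * d" using d by (intro mult_left_mono) auto
    also have "\<dots> = - t * \<beta>" using d by (simp add: t_def power2_eq_square)
    finally have "0 \<le> t * \<beta>" using quad[of t] by linarith
    moreover have "t < 0" using b d by (simp add: t_def)
    ultimately show False using b by (simp add: zero_le_mult_iff)
  qed
  then have "z = (\<lambda>x. 0)" using \<beta> z_L2 ip_self_eq_0_iff by auto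
  then have "A u x = I * u x" for x by (simp add: z_def fun_eq_iff)
  then show ?thesis using that[of u I] uV u2 I by (auto simp: V_def)
qed

text \<open>As long as fewer than \<open>n\<close> eigenvectors have been found, orthogonality to
  them imposes fewer than \<open>n\<close> linear conditions on \<open>n\<close> coefficients. A
  nonzero combination therefore satisfies them all, and its negative form value starts the next
  minimisation. Negativity for all nonzero coefficients also encodes linear independence.\<close>

lemma orthonormal_negative_eigenvectors:
  fixes \<psi> :: "nat \<Rightarrow> 'a \<Rightarrow> real"
  assumes \<psi>: "\<And>k. k < n \<Longrightarrow> \<psi> k \<in> L2 M"
    and neg: "\<And>c k. k < n \<Longrightarrow> c k \<noteq> 0 \<Longrightarrow>
      ip (\<lambda>x. \<Sum>k<n. c k * \<psi> k x) (A (\<lambda>x. \<Sum>k<n. c k * \<psi> k x)) < 0"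
    and "m \<le> n"
  shows "\<exists>B. finite B \<and> card B = m \<and> orthonormal B \<and> (\<forall>b\<in>B. \<exists>l<0. \<forall>x. A b x = l * b x)"
  using \<open>m \<le> n\<close>
proof (induction m)
  case 0
  then show ?case by (intro exI[of _ "{}"]) (auto simp: orthonormal_def)
next
  case (Suc m)
  then obtain B where B: "finite B" "card B = m" "orthonormal B" "\<forall>b\<in>B. \<exists>l<0. \<forall>x. A b x = l * b x"
    by auto
  obtain c where c: "\<exists>k\<in>{..<n}. c k \<noteq> 0" "\<forall>b\<in>B. (\<Sum>k\<in>{..<n}. c k * ip (\<psi> k) b) = 0"
    using exists_nontrivial_solution[of B "{..<n}" "\<lambda>k. ip (\<psi> k)"] B Suc.prems by auto
  define w where "w = (\<lambda>x. \<Sum>k<n. c k * \<psi> k x)"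
  have w: "w \<in> L2 M" unfolding w_def using \<psi> by (intro L2_sum L2_scale) auto
  have wb: "ip w b = 0" if "b \<in> B" for b
  proof -
    have "ip w b = (\<Sum>k<n. ip (\<lambda>x. c k * \<psi> k x) b)"
      unfolding w_def using that B \<psi> by (intro ip_sum_left) (auto simp: orthonormal_def intro: L2_scale)
    then show ?thesis using c(2) that by (simp add: ip_scale_left)
  qed
  have "ip w (A w) < 0" using neg c(1) by (auto simp: w_def)
  moreover have "B \<subseteq> L2 M" "\<And>b. b \<in> B \<Longrightarrow> \<exists>l. \<forall>x. A b x = l * b x"
    using B by (auto simp: orthonormal_def)
  ultimately obtain v l where v: "v \<in> L2 M" "\<And>b. b \<in> B \<Longrightarrow> ip v b = 0" "ip v v = 1" "l < 0"
      "\<And>x. A v x = l * v x"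
    using next_eigenvector[of B w] w wb by metis
  have "v \<notin> B" using v by force
  show ?case
  proof (intro exI conjI)
    show "finite (insert v B)" "card (insert v B) = Suc m"
      using B \<open>v \<notin> B\<close> by auto
    show "orthonormal (insert v B)"
      using B v \<open>v \<notin> B\<close> by (auto simp: orthonormal_def ip_commute)
    show "\<forall>b\<in>insert v B. \<exists>l<0. \<forall>x. A b x = l * b x" using B v by auto
  qed
qed

text \<open>Transfers the construction of negative eigenvectors to positive ones.\<close>

lemma uminus_compact_symmetric: "compact_symmetric M (\<lambda>u x. - A u x)"
proof unfold_locales
  fix u v assume "u \<in> L2 M" "v \<in> L2 M"
  then show "ip u (\<lambda>x. - A v x) = ip (\<lambda>x. - A u x) v"
    using symmetric[of u v] by (simp add: ip_def)
next
  fix U u x assume "\<And>n. U n \<in> L2 M" "\<And>n. ip (U n) (U n) \<le> 1" "\<And>x. (\<lambda>n. U n x) \<longlonglongrightarrow> u x"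
  then show "(\<lambda>n. - A (U n) x) \<longlonglongrightarrow> - A u x" by (intro tendsto_minus continuous)
qed (use bounded in \<open>auto simp: add scale\<close>)

end

section \<open>Integral operators with bounded kernel, and the projection onto mean-zero
  functions\<close>

context full_support
begin

text \<open>Each value of the image is an inner product with the bounded function
  \<open>k x\<close>, so the bound follows from \<open>ip_bound\<close> and the continuity from weak
  convergence. Symmetry is Fubini's theorem, with the kernel bound supplying integrability.\<close>

lemma kernel_compact_symmetric:
  assumes k: "\<And>x y. \<bar>k x y\<bar> \<le> C" and sym: "\<And>x y. k x y = k y x"
  shows "compact_symmetric M (\<lambda>u x. ip (k x) u)"
proof unfold_locales
  have k_L2: "k x \<in> L2 M" for x by (rule L2_bounded) (rule k)
  show "(\<lambda>x. ip (k x) (\<lambda>x. u x + v x)) = (\<lambda>x. ip (k x) u + ip (k x) v)"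
    if "u \<in> L2 M" "v \<in> L2 M" for u v
    using that k_L2 by (simp add: ip_add_right)
  show "(\<lambda>x. ip (k x) (\<lambda>x. c * u x)) = (\<lambda>x. c * ip (k x) u)" for u c
    by (simp add: ip_scale_right)
  have bound: "\<bar>ip (k x) u\<bar> \<le> C\<^sup>2 + 1" if u: "u \<in> L2 M" "ip u u \<le> 1" for u x
  proof -
    have "\<bar>ip (k x) u\<bar> \<le> 1 * ip (k x) (k x) + ip u u / 1"
      using u k_L2 by (intro ip_bound) auto
    also have "ip (k x) (k x) \<le> (\<integral>x. C\<^sup>2 \<partial>M)"
      unfolding ip_def
    proof (rule integral_mono)
      fix y
      have "\<bar>k x y\<bar> * \<bar>k x y\<bar> \<le> C * C" using k[of x y] by (intro mult_mono) auto
      then show "k x y * k x y \<le> C\<^sup>2" by (simp add: power2_eq_square)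
    qed (auto intro: integrable_mult_L2 k_L2)
    finally show ?thesis using u by (simp add: prob_space)
  qed
  then show "\<exists>C. \<forall>u\<in>L2 M. ip u u \<le> 1 \<longrightarrow> (\<forall>x. \<bar>ip (k x) u\<bar> \<le> C)"
    by (intro exI[of _ "C\<^sup>2 + 1"]) simp
  show "(\<lambda>n. ip (k x) (U n)) \<longlonglongrightarrow> ip (k x) u"
    if "\<And>n. U n \<in> L2 M" "\<And>n. ip (U n) (U n) \<le> 1" "\<And>x. (\<lambda>n. U n x) \<longlonglongrightarrow> u x" for U u x
    by (rule weak_convergence[OF that k_L2])
  show "ip u (\<lambda>x. ip (k x) v) = ip (\<lambda>x. ip (k x) u) v" if u: "u \<in> L2 M" and v: "v \<in> L2 M" for u v
  proof -
    interpret pair_sigma_finite M M ..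
    define f where "f = (\<lambda>(x, y). u x * (k x y * v y))"
    \<comment> \<open>Countability of the first factor makes any function with measurable sections
      jointly measurable.\<close>
    have "sets (M \<Otimes>\<^sub>M M) = sets (count_space UNIV \<Otimes>\<^sub>M M)"
      by (intro sets_pair_measure_cong) (auto simp: sets_M)
    moreover have "f \<in> borel_measurable (count_space UNIV \<Otimes>\<^sub>M M)"
      by (rule measurable_pair_measure_countable1[OF countable_univ]) simp
    ultimately have meas: "f \<in> borel_measurable (M \<Otimes>\<^sub>M M)"
      by (simp cong: measurable_cong_sets)
    have kv: "integrable M (\<lambda>y. k x y * v y)" for x
      using k_L2 v by (rule integrable_mult_L2)
    have "integrable (M \<Otimes>\<^sub>M M) f"
    proof (rule Fubini_integrable[OF meas])
      show "AE x in M. integrable M (\<lambda>y. f (x, y))"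
        using kv by (simp add: f_def)
      show "integrable M (\<lambda>x. \<integral>y. norm (f (x, y)) \<partial>M)"
      proof (rule Bochner_Integration.integrable_bound)
        show "integrable M (\<lambda>x. \<bar>u x\<bar> * (C * (\<integral>y. \<bar>v y\<bar> \<partial>M)))"
          using L2_integrable[OF u] by (intro integrable_mult_left integrable_abs)
        show "AE x in M. norm (\<integral>y. norm (f (x, y)) \<partial>M) \<le> norm (\<bar>u x\<bar> * (C * (\<integral>y. \<bar>v y\<bar> \<partial>M)))"
        proof (rule AE_I2)
          fix x
          have "(\<integral>y. \<bar>k x y * v y\<bar> \<partial>M) \<le> (\<integral>y. C * \<bar>v y\<bar> \<partial>M)"
          proof (rule integral_mono)
            show "integrable M (\<lambda>y. \<bar>k x y * v y\<bar>)" using kv by (rule integrable_abs)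
            show "integrable M (\<lambda>y. C * \<bar>v y\<bar>)" using L2_integrable[OF v] by simp
            show "\<bar>k x y * v y\<bar> \<le> C * \<bar>v y\<bar>" for y
              using k[of x y] by (simp add: abs_mult mult_right_mono)
          qed
          then have "\<bar>u x\<bar> * (\<integral>y. \<bar>k x y * v y\<bar> \<partial>M) \<le> \<bar>u x\<bar> * (C * (\<integral>y. \<bar>v y\<bar> \<partial>M))"
            by (intro mult_left_mono) auto
          moreover have "(\<integral>y. norm (f (x, y)) \<partial>M) = \<bar>u x\<bar> * (\<integral>y. \<bar>k x y * v y\<bar> \<partial>M)"
            by (simp add: f_def abs_mult)
          moreover have "0 \<le> (\<integral>y. norm (f (x, y)) \<partial>M)" by simp
          ultimately show "norm (\<integral>y. norm (f (x, y)) \<partial>M) \<le> norm (\<bar>u x\<bar> * (C * (\<integral>y. \<bar>v y\<bar> \<partial>M)))"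
            by (simp only: real_norm_def)
        qed
      qed simp
    qed
    then have "(\<integral>y. \<integral>x. u x * (k x y * v y) \<partial>M \<partial>M) = (\<integral>x. \<integral>y. u x * (k x y * v y) \<partial>M \<partial>M)"
      by (intro Fubini_integral) (simp add: f_def)
    moreover have "(\<integral>x. u x * (k x y * v y) \<partial>M) = ip (k y) u * v y" for y
    proof -
      have "(\<integral>x. u x * (k x y * v y) \<partial>M) = (\<integral>x. (k y x * u x) * v y \<partial>M)"
        by (intro Bochner_Integration.integral_cong) (auto simp: sym[of _ y])
      then show ?thesis by (simp add: ip_def)
    qed
    ultimately show ?thesis by (simp add: ip_def)
  qed
qed

lemma P_op_eq: "P_op M u = (\<lambda>x. u x - (\<integral>y. u y \<partial>M))"
  by (simp add: P_op_def fun_eq_iff)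

lemma P_op_L2: "u \<in> L2 M \<Longrightarrow> P_op M u \<in> L2 M"
  unfolding P_op_eq by (intro L2_diff) auto

lemma integral_P_op: "u \<in> L2 M \<Longrightarrow> (\<integral>x. P_op M u x \<partial>M) = 0"
  by (simp add: P_op_eq L2_integrable prob_space)

lemma P_op_mean_zero: "(\<integral>x. u x \<partial>M) = 0 \<Longrightarrow> P_op M u = u"
  by (simp add: P_op_eq)

lemma ip_P_op:
  assumes "u \<in> L2 M" "v \<in> L2 M"
  shows "ip (P_op M u) v = ip u v - (\<integral>x. u x \<partial>M) * (\<integral>x. v x \<partial>M)"
  unfolding P_op_eq using assms by (subst ip_diff_left) (auto simp: ip_def)

lemma P_op_symmetric: "u \<in> L2 M \<Longrightarrow> v \<in> L2 M \<Longrightarrow> ip (P_op M u) v = ip u (P_op M v)"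
  using ip_P_op[of u v] ip_P_op[of v u] ip_commute[of u v] ip_commute[of u "P_op M v"]
  by (simp add: mult.commute)

lemma P_op_contraction:
  assumes "u \<in> L2 M"
  shows "ip (P_op M u) (P_op M u) \<le> ip u u"
proof -
  have "ip (P_op M u) (P_op M u) = ip u (P_op M u)"
    using ip_P_op[OF assms P_op_L2[OF assms]] integral_P_op[OF assms] by simp
  also have "\<dots> = ip u u - (\<integral>x. u x \<partial>M)\<^sup>2"
    using ip_P_op[OF assms assms] by (simp add: ip_commute[of u "P_op M u"] power2_eq_square)
  finally show ?thesis by simp
qed

text \<open>The mean is the inner product with the constant 1, so it converges by weak
  convergence.\<close>

lemma P_op_pointwise:
  assumes "\<And>n. U n \<in> L2 M" "\<And>n. ip (U n) (U n) \<le> C" "\<And>x. (\<lambda>n. U n x) \<longlonglongrightarrow> u x"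
  shows "(\<lambda>n. P_op M (U n) x) \<longlonglongrightarrow> P_op M u x"
  unfolding P_op_eq using weak_convergence[OF assms L2_const[of 1]]
  by (intro tendsto_diff assms) (simp add: ip_def)

end

section \<open>Compression to mean-zero functions, and infinite signatures from definite
  subspaces\<close>

context compact_symmetric
begin

lemma compress_compact_symmetric: "compact_symmetric M (\<lambda>u. P_op M (A (P_op M u)))"
proof unfold_locales
  have P_add: "P_op M (\<lambda>x. u x + v x) = (\<lambda>x. P_op M u x + P_op M v x)"
    if "u \<in> L2 M" "v \<in> L2 M" for u v
    using that by (simp add: P_op_eq L2_integrable fun_eq_iff)
  have P_scale: "P_op M (\<lambda>x. c * u x) = (\<lambda>x. c * P_op M u x)" for u c
    by (simp add: P_op_eq fun_eq_iff right_diff_distrib)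
  show "P_op M (A (P_op M (\<lambda>x. u x + v x))) =
      (\<lambda>x. P_op M (A (P_op M u)) x + P_op M (A (P_op M v)) x)" if "u \<in> L2 M" "v \<in> L2 M" for u v
    using that by (simp add: P_add add P_op_L2 maps_L2)
  show "P_op M (A (P_op M (\<lambda>x. c * u x))) = (\<lambda>x. c * P_op M (A (P_op M u)) x)"
    if "u \<in> L2 M" for u c
    using that by (simp add: P_scale scale P_op_L2)
  show "ip u (P_op M (A (P_op M v))) = ip (P_op M (A (P_op M u))) v"
    if "u \<in> L2 M" "v \<in> L2 M" for u v
  proof -
    note L2 = that P_op_L2[OF that(1)] P_op_L2[OF that(2)]
    have "ip u (P_op M (A (P_op M v))) = ip (P_op M u) (A (P_op M v))"
      using L2 by (intro P_op_symmetric[symmetric] maps_L2)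
    also have "\<dots> = ip (A (P_op M u)) (P_op M v)"
      using L2 by (intro symmetric)
    also have "\<dots> = ip (P_op M (A (P_op M u))) v"
      using L2 by (intro P_op_symmetric[symmetric] maps_L2)
    finally show ?thesis .
  qed
  obtain C where C: "\<And>u x. u \<in> L2 M \<Longrightarrow> ip u u \<le> 1 \<Longrightarrow> \<bar>A u x\<bar> \<le> C"
    using bounded by blast
  have P_unit: "ip (P_op M u) (P_op M u) \<le> 1" if "u \<in> L2 M" "ip u u \<le> 1" for u
    using P_op_contraction[OF that(1)] that(2) by linarith
  have "\<bar>P_op M (A (P_op M u)) x\<bar> \<le> C + C" if u: "u \<in> L2 M" "ip u u \<le> 1" for u x
  proof -
    have 1: "\<bar>A (P_op M u) y\<bar> \<le> C" for y
      by (rule C[OF P_op_L2[OF u(1)] P_unit[OF u]])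
    have "\<bar>\<integral>y. A (P_op M u) y \<partial>M\<bar> \<le> (\<integral>y. \<bar>A (P_op M u) y\<bar> \<partial>M)"
      by (rule integral_abs_bound)
    also have "\<dots> \<le> (\<integral>y. C \<partial>M)"
      using 1 u by (intro integral_mono integrable_abs L2_integrable maps_L2 P_op_L2) auto
    finally have "\<bar>\<integral>y. A (P_op M u) y \<partial>M\<bar> \<le> C" by (simp add: prob_space)
    then show ?thesis using 1[of x] by (simp add: P_op_eq[of "A (P_op M u)"])
  qed
  then show "\<exists>C. \<forall>u\<in>L2 M. ip u u \<le> 1 \<longrightarrow> (\<forall>x. \<bar>P_op M (A (P_op M u)) x\<bar> \<le> C)"
    by (intro exI[of _ "C + C"]) simp
  show "(\<lambda>n. P_op M (A (P_op M (U n))) x) \<longlonglongrightarrow> P_op M (A (P_op M u)) x"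
    if U: "\<And>n. U n \<in> L2 M" "\<And>n. ip (U n) (U n) \<le> 1" "\<And>x. (\<lambda>n. U n x) \<longlonglongrightarrow> u x" for U u x
  proof (rule P_op_pointwise)
    show "A (P_op M (U n)) \<in> L2 M" for n using U by (intro maps_L2 P_op_L2)
    show "(\<lambda>n. A (P_op M (U n)) x) \<longlonglongrightarrow> A (P_op M u) x" for x
      by (rule continuous) (auto intro!: P_op_L2 P_unit P_op_pointwise[OF U] U)
    show "ip (A (P_op M (U n))) (A (P_op M (U n))) \<le> C * C" for n
    proof -
      have 1: "\<bar>A (P_op M (U n)) y\<bar> \<le> C" for y
        by (rule C[OF P_op_L2[OF U(1)] P_unit[OF U(1,2)]])
      have "ip (A (P_op M (U n))) (A (P_op M (U n))) \<le> (\<integral>x. C * C \<partial>M)"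
        unfolding ip_def
      proof (rule integral_mono)
        fix y
        have "\<bar>A (P_op M (U n)) y\<bar> * \<bar>A (P_op M (U n)) y\<bar> \<le> C * C"
          using 1[of y] by (intro mult_mono) auto
        then show "A (P_op M (U n)) y * A (P_op M (U n)) y \<le> C * C" by simp
      qed (auto intro!: integrable_mult_L2 maps_L2 P_op_L2 U)
      then show ?thesis by (simp add: prob_space)
    qed
  qed
qed

lemma s_minus_op_infinite:
  assumes "\<And>n. \<exists>\<psi> :: nat \<Rightarrow> 'a \<Rightarrow> real. (\<forall>k<n. \<psi> k \<in> L2 M) \<and>
    (\<forall>c. (\<exists>k<n. c k \<noteq> 0) \<longrightarrow>
      ip (\<lambda>x. \<Sum>k<n. c k * \<psi> k x) (A (\<lambda>x. \<Sum>k<n. c k * \<psi> k x)) < 0)"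
  shows "s_minus_op M A = \<infinity>"
proof -
  have "enat n \<le> s_minus_op M A" for n
  proof -
    obtain \<psi> :: "nat \<Rightarrow> 'a \<Rightarrow> real" where \<psi>: "\<forall>k<n. \<psi> k \<in> L2 M"
      "\<forall>c. (\<exists>k<n. c k \<noteq> 0) \<longrightarrow>
        ip (\<lambda>x. \<Sum>k<n. c k * \<psi> k x) (A (\<lambda>x. \<Sum>k<n. c k * \<psi> k x)) < 0"
      using assms[of n] by (elim exE conjE)
    have "\<exists>B. finite B \<and> card B = n \<and> orthonormal B \<and> (\<forall>b\<in>B. \<exists>l<0. \<forall>x. A b x = l * b x)"
    proof (rule orthonormal_negative_eigenvectors[where \<psi> = \<psi> and n = n])
      fix c :: "nat \<Rightarrow> real" and k assume "k < n" "c k \<noteq> 0"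
      then have "\<exists>k<n. c k \<noteq> 0" by blast
      with \<psi>(2) show "ip (\<lambda>x. \<Sum>k<n. c k * \<psi> k x) (A (\<lambda>x. \<Sum>k<n. c k * \<psi> k x)) < 0"
        by (elim allE impE)
    qed (use \<psi>(1) in auto)
    then obtain B where B: "finite B" "card B = n" "orthonormal B"
        "\<forall>b\<in>B. \<exists>l<0. \<forall>x. A b x = l * b x" by blast
    have "\<exists>l\<in>{..<0}. \<forall>x. A b x = l * b x" if "b \<in> B" for b
      using B(4) that by blast
    from card_le_sum_L2_dim[OF B(3,1) this] show ?thesis
      unfolding s_minus_op_def B(2) .
  qed
  then show ?thesis
    by (rule infinity_if_all_enat_le)
qed

lemma s_plus_op_infinite:
  assumes "\<And>n. \<exists>\<psi> :: nat \<Rightarrow> 'a \<Rightarrow> real. (\<forall>k<n. \<psi> k \<in> L2 M) \<and>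
    (\<forall>c. (\<exists>k<n. c k \<noteq> 0) \<longrightarrow>
      ip (\<lambda>x. \<Sum>k<n. c k * \<psi> k x) (A (\<lambda>x. \<Sum>k<n. c k * \<psi> k x)) > 0)"
  shows "s_plus_op M A = \<infinity>"
proof -
  interpret neg: compact_symmetric M "\<lambda>u x. - A u x" by (rule uminus_compact_symmetric)
  have "enat n \<le> s_plus_op M A" for n
  proof -
    obtain \<psi> :: "nat \<Rightarrow> 'a \<Rightarrow> real" where \<psi>: "\<forall>k<n. \<psi> k \<in> L2 M"
      "\<forall>c. (\<exists>k<n. c k \<noteq> 0) \<longrightarrow>
        ip (\<lambda>x. \<Sum>k<n. c k * \<psi> k x) (A (\<lambda>x. \<Sum>k<n. c k * \<psi> k x)) > 0"
      using assms[of n] by (elim exE conjE)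
    have neg_form: "ip u (\<lambda>x. - A u x) = - ip u (A u)" for u by (simp add: ip_def)
    have "\<exists>B. finite B \<and> card B = n \<and> orthonormal B \<and> (\<forall>b\<in>B. \<exists>l<0. \<forall>x. - A b x = l * b x)"
    proof (rule neg.orthonormal_negative_eigenvectors[where \<psi> = \<psi> and n = n])
      fix c :: "nat \<Rightarrow> real" and k assume "k < n" "c k \<noteq> 0"
      then have "\<exists>k<n. c k \<noteq> 0" by blast
      with \<psi>(2) show "ip (\<lambda>x. \<Sum>k<n. c k * \<psi> k x) (\<lambda>x. - A (\<lambda>x. \<Sum>k<n. c k * \<psi> k x) x) < 0"
        unfolding neg_form neg_less_0_iff_less by (elim allE impE)
    qed (use \<psi>(1) in auto)
    then obtain B where B: "finite B" "card B = n" "orthonormal B"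
        "\<forall>b\<in>B. \<exists>l<0. \<forall>x. - A b x = l * b x" by blast
    have "\<exists>l\<in>{0<..}. \<forall>x. A b x = l * b x" if b: "b \<in> B" for b
    proof -
      obtain l where "l < 0" and l: "\<And>x. - A b x = l * b x"
        using B(4) b by blast
      have "A b x = - l * b x" for x using l[of x] by linarith
      then show ?thesis using \<open>l < 0\<close> by (intro bexI[of _ "- l"]) auto
    qed
    from card_le_sum_L2_dim[OF B(3,1) this] show ?thesis
      unfolding s_plus_op_def B(2) .
  qed
  then show ?thesis
    by (rule infinity_if_all_enat_le)
qed

end


section \<open>Matrices and disjoint 4-cycles\<close>

text \<open>The \<open>n\<close> eigenvectors are completed to a basis by the last \<open>m\<close>
  unit vectors. As their top block is the identity, the base change \<open>P\<close> is unipotent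
  with explicit inverse \<open>Q\<close>, and conjugation makes the matrix block upper triangular
  with \<open>l\<close> times the identity in the corner.\<close>

lemma power_dvd_char_poly:
  fixes A :: "'a :: idom mat" and v :: "nat \<Rightarrow> nat \<Rightarrow> 'a"
  assumes A: "A \<in> carrier_mat (n + m) (n + m)"
    and eig: "\<And>i k. i < n + m \<Longrightarrow> k < n \<Longrightarrow> (\<Sum>j<n + m. A $$ (i, j) * v j k) = l * v i k"
    and v: "\<And>i k. i < n \<Longrightarrow> k < n \<Longrightarrow> v i k = (if i = k then 1 else 0)"
  shows "[:- l, 1:] ^ n dvd char_poly A"
proof -
  define R where "R = mat m n (\<lambda>(i, k). v (n + i) k)"
  define P where "P = four_block_mat (1\<^sub>m n) (0\<^sub>m n m) R (1\<^sub>m m)"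
  define Q where "Q = four_block_mat (1\<^sub>m n) (0\<^sub>m n m) (- R) (1\<^sub>m m)"
  have R: "R \<in> carrier_mat m n" by (simp add: R_def)
  have P: "P \<in> carrier_mat (n + m) (n + m)" and Q: "Q \<in> carrier_mat (n + m) (n + m)"
    using R by (auto simp: P_def Q_def)
  have PQ: "P * Q = 1\<^sub>m (n + m)"
    unfolding P_def Q_def
    by (subst mult_four_block_mat[of _ n n _ m _ m])
       (use R in \<open>auto intro!: eq_matI[where B = "1\<^sub>m (n + m)"]\<close>)
  have QP: "Q * P = 1\<^sub>m (n + m)"
    unfolding P_def Q_def
    by (subst mult_four_block_mat[of _ n n _ m _ m]) (use R in auto)
  define B where "B = Q * A * P"
  have B: "B \<in> carrier_mat (n + m) (n + m)" using A P Q by (simp add: B_def)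
  have AP: "(A * P) $$ (i, k) = l * P $$ (i, k)" if "i < n + m" "k < n" for i k
  proof -
    have Pv: "P $$ (j, k) = v j k" if "j < n + m" for j
      using that \<open>k < n\<close> v[of j k] by (auto simp: P_def R_def)
    have "(A * P) $$ (i, k) = (\<Sum>j<n + m. A $$ (i, j) * P $$ (j, k))"
      using A P that by (simp add: scalar_prod_def atLeast0LessThan)
    also have "\<dots> = l * P $$ (i, k)"
      using eig[OF that] Pv that by simp
    finally show ?thesis .
  qed
  have Bk: "B $$ (i, k) = (if i = k then l else 0)" if "i < n + m" "k < n" for i k
  proof -
    define X where "X = A * P"
    have X: "X \<in> carrier_mat (n + m) (n + m)" using A P by (simp add: X_def)
    have "B = Q * X" using A P Q by (simp add: B_def X_def assoc_mult_mat[of _ _ "n + m" _ "n + m"])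
    then have "B $$ (i, k) = (\<Sum>j<n + m. Q $$ (i, j) * (A * P) $$ (j, k))"
      using X Q that by (simp add: scalar_prod_def atLeast0LessThan flip: X_def)
    also have "\<dots> = l * (\<Sum>j<n + m. Q $$ (i, j) * P $$ (j, k))"
      using that by (simp add: AP sum_distrib_left mult.left_commute)
    also have "(\<Sum>j<n + m. Q $$ (i, j) * P $$ (j, k)) = (Q * P) $$ (i, k)"
      using P Q that by (simp add: scalar_prod_def atLeast0LessThan)
    finally show ?thesis using that by (simp add: QP)
  qed
  define A2 where "A2 = mat n m (\<lambda>(i, j). B $$ (i, n + j))"
  define A4 where "A4 = mat m m (\<lambda>(i, j). B $$ (n + i, n + j))"
  have B_block: "B = four_block_mat (l \<cdot>\<^sub>m 1\<^sub>m n) A2 (0\<^sub>m m n) A4"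
    using B Bk by (intro eq_matI) (auto simp: A2_def A4_def)
  have "char_poly_matrix B = four_block_mat ([:- l, 1:] \<cdot>\<^sub>m 1\<^sub>m n) (map_mat (\<lambda>a. [:- a:]) A2) (0\<^sub>m m n) (char_poly_matrix A4)"
    unfolding B_block by (intro eq_matI) (auto simp: char_poly_matrix_def A2_def A4_def)
  then have "char_poly B = det ([:- l, 1:] \<cdot>\<^sub>m 1\<^sub>m n) * det (char_poly_matrix A4)"
    unfolding char_poly_def
    by (simp add: det_four_block_mat_lower_left_zero[of _ n _ m] A2_def A4_def)
  also have "det ([:- l, 1:] \<cdot>\<^sub>m (1\<^sub>m n :: 'a poly mat)) = [:- l, 1:] ^ n"
    by (simp add: det_smult)
  finally have "[:- l, 1:] ^ n dvd char_poly B" by simp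
  moreover have "similar_mat A B"
  proof (rule similar_matI)
    have "P * B * Q = (P * Q) * A * (P * Q)"
      using A P Q unfolding B_def by (simp add: assoc_mult_mat[of _ _ "n + m" _ "n + m" _ "n + m"])
    then show "A = P * B * Q" using A by (simp add: PQ)
  qed (use A B P Q PQ QP in auto)
  ultimately show ?thesis by (simp add: char_poly_similar)
qed

lemma count_proots_char_poly_ge:
  fixes A :: "real mat"
  assumes A: "A \<in> carrier_mat N N" and dvd: "[:- l, 1:] ^ n dvd char_poly A"
  shows "n \<le> count (proots (char_poly A)) l"
proof -
  have "char_poly A \<noteq> 0"
    using degree_monic_char_poly[OF A] by auto
  then show ?thesis using dvd by (simp add: order_max)
qed

lemma count_le_size_filter: "P x \<Longrightarrow> count X x \<le> size (filter_mset P X)"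
  using count_le_size[of "filter_mset P X" x] by simp

text \<open>On indices \<open>i = t * n + k\<close> with \<open>t < 4\<close>, \<open>k < n\<close> the edges form \<open>n\<close> disjoint
  4-cycles if \<open>b\<close> holds; otherwise there are none.\<close>

definition cycles :: "bool \<Rightarrow> nat \<Rightarrow> nat \<Rightarrow> nat \<Rightarrow> bool" where
  "cycles b n i j \<longleftrightarrow> b \<and> i mod n = j mod n \<and> odd (i div n) \<noteq> odd (j div n)"

definition alternating :: "nat \<Rightarrow> (nat \<Rightarrow> real) \<Rightarrow> nat \<Rightarrow> real" where
  "alternating n c i = (-1) ^ (i div n) * c (i mod n)"

text \<open>The squared Rado distances between vertices inducing the graph
  \<open>cycles b n\<close>: distinct non-adjacent vertices are at distance 2.\<close>

definition cycles_dist2 :: "bool \<Rightarrow> nat \<Rightarrow> nat \<Rightarrow> nat \<Rightarrow> real" where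
  "cycles_dist2 b n i j = (if i = j then 0 else if cycles b n i j then 1 else 4)"

definition cycles_eigenvalue :: "bool \<Rightarrow> real" where
  "cycles_eigenvalue b = (if b then -1 else 2)"

lemma sum_four_blocks:
  fixes f :: "nat \<Rightarrow> 'b :: comm_monoid_add"
  shows "(\<Sum>j<4 * n. f j) = (\<Sum>k<n. f k + f (n + k) + f (2 * n + k) + f (3 * n + k))"
proof -
  have "(\<Sum>j<4 * n. f j) = (\<Sum>t<4. sum f {t * n..<t * n + n})"
    by (rule sum.nat_group[symmetric])
  also have "\<dots> = (\<Sum>t<4. \<Sum>k<n. f (t * n + k))"
  proof (rule sum.cong[OF refl])
    fix t
    show "sum f {t * n..<t * n + n} = (\<Sum>k<n. f (t * n + k))"
      using sum.shift_bounds_nat_ivl[of f 0 "t * n" n] by (simp add: atLeast0LessThan add.commute)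
  qed
  finally show ?thesis
    by (simp add: eval_nat_numeral sum.distrib)
qed

text \<open>A foreign cycle contributes four equal weights with alternating signs, hence 0. On the
  own cycle, relative to the value at \<open>i\<close>, the weights at \<open>i\<close>, the
  opposite vertex and the two neighbours give \<open>- (1/2) * (0 + 4 - 1 - 1) = -1\<close>. Without
  edges they give \<open>- (1/2) * (0 + 4 - 4 - 4) = 2\<close>.\<close>

lemma cycles_eigenvector:
  assumes i: "i < 4 * n"
  shows "(\<Sum>j<4 * n. - (1/2) * cycles_dist2 b n i j * alternating n c j) =
    cycles_eigenvalue b * alternating n c i"
proof -
  define t k where "t = i div n" and "k = i mod n"
  have n: "n > 0" using i by (cases n) auto
  have k: "k < n" using n by (simp add: k_def)
  have t: "t < 4" using i n by (simp add: t_def div_less_iff_less_mult)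
  have ik: "i = t * n + k" by (simp add: t_def k_def)
  define g where "g s k' = - (1/2) * (if t = s \<and> k = k' then 0 else
      if b \<and> k = k' \<and> odd t \<noteq> odd s then 1 else 4) * ((-1) ^ s * c k' :: real)" for s k'
  have g: "- (1/2) * cycles_dist2 b n i (s * n + k') * alternating n c (s * n + k') = g s k'"
    if "k' < n" for s k'
  proof -
    have 1: "(s * n + k') div n = s" "(s * n + k') mod n = k'" using that by auto
    then have "i = s * n + k' \<longleftrightarrow> t = s \<and> k = k'"
      unfolding t_def k_def by (metis div_mult_mod_eq)
    then show ?thesis
      by (simp add: g_def cycles_dist2_def cycles_def alternating_def 1 flip: t_def k_def del: mod_mult_self3 mod_mult_self4 mod_less)
  qed
  have "(\<Sum>j<4 * n. - (1/2) * cycles_dist2 b n i j * alternating n c j) =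
      (\<Sum>k'<n. g 0 k' + g 1 k' + g 2 k' + g 3 k')"
    unfolding sum_four_blocks
    by (intro sum.cong refl) (use g[of _ 0] g[of _ 1] g[of _ 2] g[of _ 3] in simp)
  also have "\<dots> = (\<Sum>k'<n. if k' = k then cycles_eigenvalue b * ((-1) ^ t * c k) else 0)"
  proof (rule sum.cong[OF refl])
    fix k'
    have "t = 0 \<or> t = 1 \<or> t = 2 \<or> t = 3" using t by linarith
    then show "g 0 k' + g 1 k' + g 2 k' + g 3 k' =
        (if k' = k then cycles_eigenvalue b * ((-1) ^ t * c k) else 0)"
      by (elim disjE) (simp_all add: g_def cycles_eigenvalue_def)
  qed
  also have "\<dots> = cycles_eigenvalue b * alternating n c i"
    using k by (simp add: alternating_def t_def k_def)
  finally show ?thesis .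
qed

lemma sum_alternating: "(\<Sum>j<4 * n. alternating n c j) = 0"
proof -
  have *: "alternating n c (s * n + k) = (-1) ^ s * c k" if "k < n" for s k
    using that by (simp add: alternating_def)
  show ?thesis
    unfolding sum_four_blocks
    by (intro sum.neutral) (use *[of _ 0] *[of _ 1] *[of _ 2] *[of _ 3] in simp)
qed


section \<open>The Rado graph\<close>

context
  fixes E :: "'a \<Rightarrow> 'a \<Rightarrow> bool"
  assumes rado: "rado_graph E"
begin

lemma rado_sym: "E x y = E y x"
  using rado by (auto simp: rado_graph_def symp_def)

lemma rado_irrefl: "\<not> E x x"
  using rado by (auto simp: rado_graph_def irreflp_def)

lemma rado_extension:
  assumes "finite U" "finite V" "U \<inter> V = {}"
  obtains x where "x \<notin> U \<union> V" "\<And>u. u \<in> U \<Longrightarrow> E x u" "\<And>v. v \<in> V \<Longrightarrow> \<not> E x v"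
  using rado assms unfolding rado_graph_def by metis

text \<open>The extension property for \<open>{x, y}\<close> and the empty set provides a common
  neighbour of any two vertices, so the diameter is at most 2.\<close>

lemma graph_dist_rado: "graph_dist E x y = (if x = y then 0 else if E x y then 1 else 2)"
proof -
  have p1: "(E ^^ 1) x y \<longleftrightarrow> E x y" for x y by auto
  show ?thesis
  proof (cases "x = y")
    case True
    then have "(LEAST n. (E ^^ n) x y) = 0" by (intro Least_eq_0) simp
    then show ?thesis using True by (simp add: graph_dist_def)
  next
    case neq: False
    then have 0: "\<not> (E ^^ 0) x y" by simp
    show ?thesis
    proof (cases "E x y")
      case True
      have "(LEAST n. (E ^^ n) x y) = 1"
      proof (rule Least_equality)
        show "(E ^^ 1) x y" using True p1 by blast
        show "1 \<le> n" if "(E ^^ n) x y" for n using that 0 by (cases n) auto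
      qed
      then show ?thesis using neq True by (simp add: graph_dist_def)
    next
      case False
      obtain z where z: "E z x" "E z y"
        by (rule rado_extension[of "{x, y}" "{}"]) auto
      have "(LEAST n. (E ^^ n) x y) = 2"
      proof (rule Least_equality)
        have "(E OO E) x y" using z rado_sym by blast
        then show "(E ^^ 2) x y" by (simp add: numeral_2_eq_2 eq_OO)
        show "2 \<le> n" if "(E ^^ n) x y" for n
        proof (rule ccontr)
          assume "\<not> 2 \<le> n"
          then have "n = 0 \<or> n = 1" by linarith
          then show False using that 0 p1 False by blast
        qed
      qed
      then show ?thesis using neq False by (simp add: graph_dist_def)
    qed
  qed
qed

section \<open>Finite induced subgraphs and the signature of the metric\<close>

text \<open>Vertices are added one at a time, by the extension property for the images of the
  neighbours and of the non-neighbours of the new vertex. The new image lies outside both sets,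
  which preserves injectivity.\<close>

lemma rado_embedding:
  fixes G :: "nat \<Rightarrow> nat \<Rightarrow> bool"
  assumes G: "\<And>i j. G i j = G j i" "\<And>i. \<not> G i i"
  shows "\<exists>x. inj_on x {..<N} \<and> (\<forall>i<N. \<forall>j<N. E (x i) (x j) = G i j)"
proof (induction N)
  case (Suc N)
  then obtain x where x: "inj_on x {..<N}" "\<forall>i<N. \<forall>j<N. E (x i) (x j) = G i j" by blast
  obtain z where z: "z \<notin> x ` {i. i < N \<and> G N i} \<union> x ` {i. i < N \<and> \<not> G N i}"
      "\<And>u. u \<in> x ` {i. i < N \<and> G N i} \<Longrightarrow> E z u" "\<And>v. v \<in> x ` {i. i < N \<and> \<not> G N i} \<Longrightarrow> \<not> E z v"
    by (rule rado_extension[of "x ` {i. i < N \<and> G N i}" "x ` {i. i < N \<and> \<not> G N i}"])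
       (use x(1) in \<open>auto simp: inj_on_def\<close>)
  have zN: "E z (x i) = G N i" "z \<noteq> x i" if "i < N" for i
    using z that by (cases "G N i"; blast)+
  show ?case
  proof (intro exI[of _ "x(N := z)"] conjI allI impI)
    show "inj_on (x(N := z)) {..<Suc N}"
    proof (rule inj_onI)
      fix i j assume "i \<in> {..<Suc N}" "j \<in> {..<Suc N}" and eq: "(x(N := z)) i = (x(N := z)) j"
      then consider "i < N" "j < N" | "i < N" "j = N" | "i = N" "j < N" | "i = N" "j = N"
        by (auto simp: less_Suc_eq)
      then show "i = j"
        using eq x(1) zN(2)[of i] zN(2)[of j] by cases (auto dest: inj_onD)
    qed
    show "E ((x(N := z)) i) ((x(N := z)) j) = G i j" if "i < Suc N" "j < Suc N" for i j
      using that x(2) zN(1) G rado_irrefl rado_sym[of _ z] by (auto simp: less_Suc_eq)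
  qed
qed (rule exI[of _ undefined], simp)

lemma rado_cycles:
  obtains x where "inj_on x {..<4 * n}"
    "\<And>i j. i < 4 * n \<Longrightarrow> j < 4 * n \<Longrightarrow> (graph_dist E (x i) (x j))\<^sup>2 = cycles_dist2 b n i j"
proof -
  obtain x where x: "inj_on x {..<4 * n}" "\<forall>i<4 * n. \<forall>j<4 * n. E (x i) (x j) = cycles b n i j"
  proof -
    have "\<exists>x. inj_on x {..<4 * n} \<and> (\<forall>i<4 * n. \<forall>j<4 * n. E (x i) (x j) = cycles b n i j)"
      by (rule rado_embedding) (auto simp: cycles_def)
    then show ?thesis using that by blast
  qed
  have "(graph_dist E (x i) (x j))\<^sup>2 = cycles_dist2 b n i j" if "i < 4 * n" "j < 4 * n" for i j
    using that x inj_onD[OF x(1), of i j] by (auto simp: graph_dist_rado cycles_dist2_def)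
  then show ?thesis using that x(1) by blast
qed

lemma rado_S_mat_eigenvalue:
  obtains xs where "distinct xs" "n \<le> count (proots (char_poly (S_mat (graph_dist E) xs))) (cycles_eigenvalue b)"
proof -
  obtain x where x: "inj_on x {..<4 * n}"
    "\<And>i j. i < 4 * n \<Longrightarrow> j < 4 * n \<Longrightarrow> (graph_dist E (x i) (x j))\<^sup>2 = cycles_dist2 b n i j"
    by (rule rado_cycles) (rule that)
  define xs where "xs = map x [0..<4 * n]"
  define A where "A = S_mat (graph_dist E) xs"
  have A: "A \<in> carrier_mat (n + 3 * n) (n + 3 * n)"
    by (simp add: A_def S_mat_def xs_def)
  have Aij: "A $$ (i, j) = - (1/2) * cycles_dist2 b n i j" if "i < 4 * n" "j < 4 * n" for i j
    using that by (simp add: A_def S_mat_def xs_def x(2))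
  have "[:- cycles_eigenvalue b, 1:] ^ n dvd char_poly A"
  \<comment> \<open>The \<open>k\<close>-th eigenvector has amplitude 1 on cycle \<open>k\<close>
    and 0 elsewhere. The first \<open>n\<close> indices hold one vertex of each cycle, with positive
    sign, and so supply the identity block.\<close>
  proof (rule power_dvd_char_poly[OF A, where v = "\<lambda>i k. alternating n (\<lambda>k'. if k' = k then 1 else 0) i"])
    fix i k assume "i < n + 3 * n" "k < n"
    then have "i < 4 * n" by simp
    from cycles_eigenvector[OF this]
    show "(\<Sum>j<n + 3 * n. A $$ (i, j) * alternating n (\<lambda>k'. if k' = k then 1 else 0) j) =
        cycles_eigenvalue b * alternating n (\<lambda>k'. if k' = k then 1 else 0) i"
      using \<open>i < 4 * n\<close> by (simp add: Aij)
  qed (auto simp: alternating_def)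
  then have "n \<le> count (proots (char_poly A)) (cycles_eigenvalue b)"
    by (rule count_proots_char_poly_ge[OF A])
  moreover have "distinct xs" using x(1) by (simp add: xs_def distinct_map atLeast0LessThan)
  ultimately show ?thesis using that unfolding A_def by blast
qed

lemma s_plus_rado: "s_plus UNIV (graph_dist E) = \<infinity>"
proof (rule infinity_if_all_enat_le)
  fix n
  obtain xs where xs: "distinct xs" "n \<le> count (proots (char_poly (S_mat (graph_dist E) xs))) (cycles_eigenvalue False)"
    by (rule rado_S_mat_eigenvalue)
  then have "n \<le> s_plus_mat (S_mat (graph_dist E) xs)"
    unfolding s_plus_mat_def
    by (elim order.trans) (intro count_le_size_filter, simp add: cycles_eigenvalue_def)
  then have "enat n \<le> enat (s_plus_mat (S_mat (graph_dist E) xs))" by simp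
  also have "\<dots> \<le> s_plus UNIV (graph_dist E)"
    unfolding s_plus_def using xs by (intro SUP_upper) auto
  finally show "enat n \<le> s_plus UNIV (graph_dist E)" .
qed

lemma s_minus_rado: "s_minus UNIV (graph_dist E) = \<infinity>"
proof (rule infinity_if_all_enat_le)
  fix n
  obtain xs where xs: "distinct xs" "n \<le> count (proots (char_poly (S_mat (graph_dist E) xs))) (cycles_eigenvalue True)"
    by (rule rado_S_mat_eigenvalue)
  then have "n \<le> s_minus_mat (S_mat (graph_dist E) xs)"
    unfolding s_minus_mat_def
    by (elim order.trans) (intro count_le_size_filter, simp add: cycles_eigenvalue_def)
  then have "enat n \<le> enat (s_minus_mat (S_mat (graph_dist E) xs))" by simp
  also have "\<dots> \<le> s_minus UNIV (graph_dist E)"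
    unfolding s_minus_def using xs by (intro SUP_upper) auto
  finally show "enat n \<le> s_minus UNIV (graph_dist E)" .
qed

end

section \<open>Test functions supported on 4-cycles\<close>

context full_support
begin

lemma cycles_test_functions:
  fixes d :: "'a \<Rightarrow> 'a \<Rightarrow> real" and x :: "nat \<Rightarrow> 'a"
  assumes x: "inj_on x {..<4 * n}"
    and d: "\<And>i j. i < 4 * n \<Longrightarrow> j < 4 * n \<Longrightarrow> (d (x i) (x j))\<^sup>2 = cycles_dist2 b n i j"
  obtains \<psi> :: "nat \<Rightarrow> 'a \<Rightarrow> real" where "\<And>k. \<psi> k \<in> L2 M"
    "\<And>c. (\<integral>y. (\<Sum>k<n. c k * \<psi> k y) \<partial>M) = 0"
    "\<And>c. ip (\<lambda>y. \<Sum>k<n. c k * \<psi> k y) (K_op d M (\<lambda>y. \<Sum>k<n. c k * \<psi> k y)) =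
      cycles_eigenvalue b * (\<Sum>i<4 * n. (alternating n c i)\<^sup>2)"
proof -
  define \<iota> where "\<iota> = the_inv_into {..<4 * n} x"
  \<comment> \<open>Dividing by the mass of the vertex cancels the weights of the measure: integrals
    against combinations of the \<open>\<psi> k\<close> become plain sums over indices, and the
    operator acts as the matrix does.\<close>
  define \<psi> where "\<psi> k y = (if y \<in> x ` {..<4 * n} \<and> \<iota> y mod n = k
    then (-1) ^ (\<iota> y div n) / measure M {y} else 0)" for k y
  define u where "u c y = (\<Sum>k<n. c k * \<psi> k y)" for c y
  have u_out: "u c y = 0" if "y \<notin> x ` {..<4 * n}" for c y
    unfolding u_def \<psi>_def by (simp only: that simp_thms if_False mult_zero_right sum.neutral_const)
  have u_in: "measure M {x i} * u c (x i) = alternating n c i" if i: "i < 4 * n" for c i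
  proof -
    have \<iota>: "\<iota> (x i) = i" unfolding \<iota>_def using x i by (simp add: the_inv_into_f_f)
    have n: "i mod n < n" using i by (cases n) auto
    have "u c (x i) = (\<Sum>k<n. if k = i mod n then c k * ((-1) ^ (i div n) / measure M {x i}) else 0)"
      unfolding u_def by (intro sum.cong) (use i in \<open>auto simp: \<psi>_def \<iota>\<close>)
    also have "\<dots> = c (i mod n) * ((-1) ^ (i div n) / measure M {x i})"
      using n by simp
    finally show ?thesis
      using measure_pos[of "x i"] by (simp add: alternating_def)
  qed
  have int: "(\<integral>y. f y * u c y \<partial>M) = (\<Sum>i<4 * n. f (x i) * alternating n c i)" for f c
  proof -
    have "(\<integral>y. f y * u c y \<partial>M) = (\<Sum>y\<in>x ` {..<4 * n}. measure M {y} * (f y * u c y))"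
      by (rule integral_finite_support(2)) (auto simp: u_out)
    also have "\<dots> = (\<Sum>i<4 * n. measure M {x i} * (f (x i) * u c (x i)))"
      by (simp add: sum.reindex[OF x])
    also have "\<dots> = (\<Sum>i<4 * n. f (x i) * alternating n c i)"
      by (intro sum.cong refl) (simp add: u_in[symmetric])
    finally show ?thesis .
  qed
  have K: "K_op d M (u c) (x i) = cycles_eigenvalue b * alternating n c i" if i: "i < 4 * n" for c i
  proof -
    have "K_op d M (u c) (x i) = (\<Sum>j<4 * n. - (1/2) * cycles_dist2 b n i j * alternating n c j)"
      unfolding K_op_def int by (simp add: sum_distrib_left d[OF i] mult.assoc)
    then show ?thesis by (simp only: cycles_eigenvector[OF i])
  qed
  show ?thesis
  proof
    show "\<psi> k \<in> L2 M" for k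
      by (rule L2_finite_support[of "x ` {..<4 * n}"]) (auto simp: \<psi>_def)
    show "(\<integral>y. (\<Sum>k<n. c k * \<psi> k y) \<partial>M) = 0" for c
      using int[of "\<lambda>_. 1" c] by (simp add: u_def sum_alternating)
    show "ip (\<lambda>y. \<Sum>k<n. c k * \<psi> k y) (K_op d M (\<lambda>y. \<Sum>k<n. c k * \<psi> k y)) =
      cycles_eigenvalue b * (\<Sum>i<4 * n. (alternating n c i)\<^sup>2)" for c
    proof -
      \<comment> \<open>The function \<open>u c\<close> is supported on the chosen vertices, so the
        form samples its image only there, where the eigenvalue relation \<open>K\<close>
        holds.\<close>
      have "ip (u c) (K_op d M (u c)) = (\<integral>y. K_op d M (u c) y * u c y \<partial>M)"
        by (simp add: ip_def mult.commute)
      also have "\<dots> = (\<Sum>i<4 * n. cycles_eigenvalue b * (alternating n c i)\<^sup>2)"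
        unfolding int by (intro sum.cong refl) (simp add: K power2_eq_square)
      finally show ?thesis by (simp add: u_def[abs_def] sum_distrib_left)
    qed
  qed
qed

lemma sum_alternating_square_pos:
  assumes "\<exists>k<n. c k \<noteq> 0"
  shows "0 < (\<Sum>i<4 * n. (alternating n c i)\<^sup>2)"
proof -
  obtain k where "k < n" "c k \<noteq> 0" using assms by blast
  then show ?thesis
    by (intro sum_pos2[where i = k]) (auto simp: alternating_def)
qed

end

section \<open>The operators of the Rado graph\<close>

locale rado_measure = full_support M for M :: "'a measure" +
  fixes E :: "'a \<Rightarrow> 'a \<Rightarrow> bool"
  assumes rado: "rado_graph E"
begin

abbreviation "K \<equiv> K_op (graph_dist E) M"
abbreviation "T \<equiv> T_op (graph_dist E) M"

lemma compact_symmetric_K: "compact_symmetric M K"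
proof -
  define k where "k x y = - (1/2) * (graph_dist E x y)\<^sup>2" for x y
  have "compact_symmetric M (\<lambda>u x. ip (k x) u)"
  proof (rule kernel_compact_symmetric)
    show "\<bar>k x y\<bar> \<le> 2" "k x y = k y x" for x y
      using rado_sym[OF rado, of x y] by (auto simp: k_def graph_dist_rado[OF rado])
  qed
  moreover have "(\<lambda>u x. ip (k x) u) = K"
    by (simp add: fun_eq_iff K_op_def ip_def k_def mult.assoc)
  ultimately show ?thesis by simp
qed

sublocale K: compact_symmetric M K
  by (rule compact_symmetric_K)

sublocale T: compact_symmetric M T
  using K.compress_compact_symmetric by (simp add: T_op_def[abs_def])

text \<open>A mean-zero function is fixed by the symmetric projection \<open>P_op M\<close>, so the
  forms of \<open>K\<close> and \<open>T\<close> agree on it.\<close>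

lemma test_functions:
  fixes n :: nat
  obtains \<psi> :: "nat \<Rightarrow> 'a \<Rightarrow> real" where "\<And>k. \<psi> k \<in> L2 M"
    "\<And>c. ip (\<lambda>y. \<Sum>k<n. c k * \<psi> k y) (K (\<lambda>y. \<Sum>k<n. c k * \<psi> k y)) =
      cycles_eigenvalue b * (\<Sum>i<4 * n. (alternating n c i)\<^sup>2)"
    "\<And>c. ip (\<lambda>y. \<Sum>k<n. c k * \<psi> k y) (T (\<lambda>y. \<Sum>k<n. c k * \<psi> k y)) =
      cycles_eigenvalue b * (\<Sum>i<4 * n. (alternating n c i)\<^sup>2)"
proof -
  obtain x where x: "inj_on x {..<4 * n}"
    "\<And>i j. i < 4 * n \<Longrightarrow> j < 4 * n \<Longrightarrow> (graph_dist E (x i) (x j))\<^sup>2 = cycles_dist2 b n i j"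
    by (rule rado_cycles[OF rado]) (rule that)
  obtain \<psi> :: "nat \<Rightarrow> 'a \<Rightarrow> real" where \<psi>: "\<And>k. \<psi> k \<in> L2 M"
    "\<And>c. (\<integral>y. (\<Sum>k<n. c k * \<psi> k y) \<partial>M) = 0"
    "\<And>c. ip (\<lambda>y. \<Sum>k<n. c k * \<psi> k y) (K (\<lambda>y. \<Sum>k<n. c k * \<psi> k y)) =
      cycles_eigenvalue b * (\<Sum>i<4 * n. (alternating n c i)\<^sup>2)"
    using cycles_test_functions[of x n "graph_dist E" b] x by blast
  show ?thesis
  proof (rule that[OF \<psi>(1,3)])
    fix c :: "nat \<Rightarrow> real"
    define u where "u = (\<lambda>y. \<Sum>k<n. c k * \<psi> k y)"
    have u: "u \<in> L2 M" unfolding u_def by (intro L2_sum L2_scale \<psi>(1))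
    have P: "P_op M u = u" using \<psi>(2)[of c] by (intro P_op_mean_zero) (simp add: u_def)
    have "ip u (T u) = ip (P_op M u) (K u)"
      unfolding T_op_def P_op_symmetric[OF u K.maps_L2[OF u]] by (simp only: P)
    then show "ip (\<lambda>y. \<Sum>k<n. c k * \<psi> k y) (T (\<lambda>y. \<Sum>k<n. c k * \<psi> k y)) =
        cycles_eigenvalue b * (\<Sum>i<4 * n. (alternating n c i)\<^sup>2)"
      using \<psi>(3)[of c] by (simp only: P flip: u_def)
  qed
qed

lemma infinite_signatures:
  "s_plus_op M K = \<infinity>" "s_minus_op M K = \<infinity>" "s_plus_op M T = \<infinity>" "s_minus_op M T = \<infinity>"
proof -
  note pos = sum_alternating_square_pos
  \<comment> \<open>Independent vertices have eigenvalue 2 and give the positive forms; 4-cycles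
    have eigenvalue -1 and give the negative ones.\<close>
  have plus: "\<exists>\<psi> :: nat \<Rightarrow> 'a \<Rightarrow> real. (\<forall>k<n. \<psi> k \<in> L2 M) \<and>
      (\<forall>c. (\<exists>k<n. c k \<noteq> 0) \<longrightarrow> ip (\<lambda>x. \<Sum>k<n. c k * \<psi> k x) (A (\<lambda>x. \<Sum>k<n. c k * \<psi> k x)) > 0)"
    if A: "A = K \<or> A = T" for A and n :: nat
  proof (rule test_functions[of n False])
    fix \<psi> :: "nat \<Rightarrow> 'a \<Rightarrow> real" assume "\<And>k. \<psi> k \<in> L2 M"
    "\<And>c. ip (\<lambda>y. \<Sum>k<n. c k * \<psi> k y) (K (\<lambda>y. \<Sum>k<n. c k * \<psi> k y)) =
      cycles_eigenvalue False * (\<Sum>i<4 * n. (alternating n c i)\<^sup>2)"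
    "\<And>c. ip (\<lambda>y. \<Sum>k<n. c k * \<psi> k y) (T (\<lambda>y. \<Sum>k<n. c k * \<psi> k y)) =
      cycles_eigenvalue False * (\<Sum>i<4 * n. (alternating n c i)\<^sup>2)"
    then show ?thesis using A pos
      by (intro exI[of _ \<psi>]) (elim disjE, simp_all add: cycles_eigenvalue_def)
  qed
  have minus: "\<exists>\<psi> :: nat \<Rightarrow> 'a \<Rightarrow> real. (\<forall>k<n. \<psi> k \<in> L2 M) \<and>
      (\<forall>c. (\<exists>k<n. c k \<noteq> 0) \<longrightarrow> ip (\<lambda>x. \<Sum>k<n. c k * \<psi> k x) (A (\<lambda>x. \<Sum>k<n. c k * \<psi> k x)) < 0)"
    if A: "A = K \<or> A = T" for A and n :: nat
  proof (rule test_functions[of n True])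
    fix \<psi> :: "nat \<Rightarrow> 'a \<Rightarrow> real" assume "\<And>k. \<psi> k \<in> L2 M"
    "\<And>c. ip (\<lambda>y. \<Sum>k<n. c k * \<psi> k y) (K (\<lambda>y. \<Sum>k<n. c k * \<psi> k y)) =
      cycles_eigenvalue True * (\<Sum>i<4 * n. (alternating n c i)\<^sup>2)"
    "\<And>c. ip (\<lambda>y. \<Sum>k<n. c k * \<psi> k y) (T (\<lambda>y. \<Sum>k<n. c k * \<psi> k y)) =
      cycles_eigenvalue True * (\<Sum>i<4 * n. (alternating n c i)\<^sup>2)"
    then show ?thesis using A pos
      by (intro exI[of _ \<psi>]) (elim disjE, simp_all add: cycles_eigenvalue_def)
  qed
  show "s_plus_op M K = \<infinity>" by (rule K.s_plus_op_infinite, rule plus) simp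
  show "s_minus_op M K = \<infinity>" by (rule K.s_minus_op_infinite, rule minus) simp
  show "s_plus_op M T = \<infinity>" by (rule T.s_plus_op_infinite, rule plus) simp
  show "s_minus_op M T = \<infinity>" by (rule T.s_minus_op_infinite, rule minus) simp
qed

text \<open>The extension property provides a vertex \<open>x\<close> outside a finite set \<open>F\<close> carrying almost all
  of the mass of \<open>w\<close>, whose neighbours in \<open>F\<close> form a prescribed set \<open>U\<close>; at \<open>x\<close> the left-hand
  side is then close to \<open>3 * (\<Sum>y\<in>U. measure M {y} * w y)\<close>.\<close>

lemma constant_potential:
  assumes w: "integrable M w"
    and C: "\<And>x. 4 * (measure M {x} * w x) + 3 * (\<integral>y. of_bool (E x y) * w y \<partial>M) = C"
    and U: "finite U"
  shows "C = 3 * (\<Sum>y\<in>U. measure M {y} * w y)"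
proof (rule ccontr)
  assume "C \<noteq> 3 * (\<Sum>y\<in>U. measure M {y} * w y)"
  \<comment> \<open>The factor 7 is 4 + 3: the mass term at \<open>x\<close> and the neighbourhood
    integral each err by at most the tail, with coefficients 4 and 3.\<close>
  then have e: "\<bar>C - 3 * (\<Sum>y\<in>U. measure M {y} * w y)\<bar> / 7 > 0" by simp
  obtain F where F: "finite F" "U \<subseteq> F"
    "(\<integral>y. \<bar>w y\<bar> * indicator (- F) y \<partial>M) < \<bar>C - 3 * (\<Sum>y\<in>U. measure M {y} * w y)\<bar> / 7"
    by (rule finite_tail[OF w e U])
  define tail where "tail = (\<integral>y. \<bar>w y\<bar> * indicator (- F) y \<partial>M)"
  have int_tail: "integrable M (\<lambda>y. \<bar>w y\<bar> * indicator (- F) y)"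
    by (rule Bochner_Integration.integrable_bound[OF w]) (auto simp: indicator_def)
  obtain x where "x \<notin> U \<union> (F - U)" and x: "\<And>u. u \<in> U \<Longrightarrow> E x u" "\<And>v. v \<in> F - U \<Longrightarrow> \<not> E x v"
    by (rule rado_extension[OF rado, of U "F - U"]) (use U F in auto)
  then have xF: "x \<notin> F" by auto
  have "\<bar>measure M {x} * w x\<bar> \<le> tail"
  proof -
    have "\<bar>measure M {x} * w x\<bar> = (\<integral>y. \<bar>w y\<bar> * indicator {x} y \<partial>M)"
      by (subst integral_finite_support(2)[of "{x}"]) (auto simp: abs_mult)
    also have "\<dots> \<le> tail"
      unfolding tail_def
    proof (rule integral_mono[OF _ int_tail])
      show "integrable M (\<lambda>y. \<bar>w y\<bar> * indicator {x} y)"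
        by (rule integral_finite_support(1)[of "{x}"]) auto
    qed (use xF in \<open>auto simp: indicator_def\<close>)
    finally show ?thesis .
  qed
  moreover have "\<bar>(\<integral>y. of_bool (E x y) * w y \<partial>M) - (\<Sum>y\<in>U. measure M {y} * w y)\<bar> \<le> tail"
  proof -
    have 1: "integrable M (\<lambda>y. of_bool (E x y) * w y)"
      by (rule Bochner_Integration.integrable_bound[OF w]) auto
    have 2: "integrable M (\<lambda>y. of_bool (y \<in> U) * w y)"
        "(\<integral>y. of_bool (y \<in> U) * w y \<partial>M) = (\<Sum>y\<in>U. measure M {y} * w y)"
      using integral_finite_support[OF U, of "\<lambda>y. of_bool (y \<in> U) * w y"] by auto
    have "(\<integral>y. of_bool (E x y) * w y \<partial>M) - (\<Sum>y\<in>U. measure M {y} * w y) =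
        (\<integral>y. of_bool (E x y) * w y - of_bool (y \<in> U) * w y \<partial>M)"
      using 1 2 by simp
    also have "\<bar>\<dots>\<bar> \<le> (\<integral>y. \<bar>of_bool (E x y) * w y - of_bool (y \<in> U) * w y\<bar> \<partial>M)"
      by (rule integral_abs_bound)
    also have "\<dots> \<le> tail"
      unfolding tail_def
    proof (rule integral_mono[OF _ int_tail])
      show "integrable M (\<lambda>y. \<bar>of_bool (E x y) * w y - of_bool (y \<in> U) * w y\<bar>)"
        using 1 2 by (intro integrable_abs Bochner_Integration.integrable_diff)
      show "\<bar>of_bool (E x y) * w y - of_bool (y \<in> U) * w y\<bar> \<le> \<bar>w y\<bar> * indicator (- F) y" for y
        using x F(2) by (cases "y \<in> F"; cases "y \<in> U") auto
    qed
    finally show ?thesis .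
  qed
  moreover have "C - 3 * (\<Sum>y\<in>U. measure M {y} * w y) = 4 * (measure M {x} * w x) +
      3 * ((\<integral>y. of_bool (E x y) * w y \<partial>M) - (\<Sum>y\<in>U. measure M {y} * w y))"
    by (subst C[of x, symmetric]) (simp only: right_diff_distrib)
  moreover have False
    if "\<bar>a\<bar> \<le> t" "\<bar>b\<bar> \<le> t" "r = 4 * a + 3 * b" "t < \<bar>r\<bar> / 7" for a b r t :: real
    using that by (simp add: abs_if split: if_splits)
  ultimately show False
    using F(3) unfolding tail_def by blast
qed

text \<open>The squared distance is 4, minus 4 on the diagonal, minus 3 on edges. The mean-zero
  condition removes the first term, and clearing the factor \<open>- (1/2)\<close> gives the
  constant \<open>2 * C\<close>. Evaluated with the empty set it is 0, with \<open>{x}\<close> it is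
  three times \<open>measure M {x} * w x\<close>.\<close>

lemma kernel_T_mean_zero:
  assumes w: "w \<in> L2 M" "(\<integral>y. w y \<partial>M) = 0" and K: "\<And>x. K w x = C"
  shows "w x = 0"
proof -
  note int = L2_integrable[OF w(1)]
  have eq: "4 * (measure M {x} * w x) + 3 * (\<integral>y. of_bool (E x y) * w y \<partial>M) = 2 * C" for x
  proof -
    have 1: "integrable M (\<lambda>y. of_bool (E x y) * w y)"
      by (rule Bochner_Integration.integrable_bound[OF int]) auto
    have 2: "integrable M (\<lambda>y. of_bool (y = x) * w y)"
        "(\<integral>y. of_bool (y = x) * w y \<partial>M) = measure M {x} * w x"
      using integral_finite_support[of "{x}" "\<lambda>y. of_bool (y = x) * w y"] by auto
    have "(graph_dist E x y)\<^sup>2 * w y = 4 * w y - 4 * (of_bool (y = x) * w y) - 3 * (of_bool (E x y) * w y)" for y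
      using rado_irrefl[OF rado, of x] by (auto simp: graph_dist_rado[OF rado])
    then have "(\<integral>y. (graph_dist E x y)\<^sup>2 * w y \<partial>M) =
        4 * (\<integral>y. w y \<partial>M) - 4 * (\<integral>y. of_bool (y = x) * w y \<partial>M) - 3 * (\<integral>y. of_bool (E x y) * w y \<partial>M)"
      using int 1 2(1) by simp
    then show ?thesis
      using K[of x] unfolding K_op_def w(2) 2(2) by linarith
  qed
  from constant_potential[OF int eq, of "{}"] constant_potential[OF int eq, of "{x}"]
  have "measure M {x} * w x = 0" by simp
  then show ?thesis using measure_pos[of x] by simp
qed

lemma L2_kernel_T: "L2_kernel M T = {u \<in> L2 M. \<exists>c. AE x in M. u x = c}"
proof (intro Set.set_eqI iffI)
  fix u assume "u \<in> L2_kernel M T"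
  then have u: "u \<in> L2 M" and T: "\<And>x. T u x = 0"
    by (auto simp: L2_kernel_def AE_iff_all)
  have P: "P_op M u x = 0" for x
  proof (rule kernel_T_mean_zero[OF P_op_L2[OF u] integral_P_op[OF u]])
    \<comment> \<open>\<open>T u = 0\<close> says that \<open>K (P_op M u)\<close> coincides with
      its own mean, so it is constant.\<close>
    show "K (P_op M u) x = (\<integral>y. K (P_op M u) y \<partial>M)" for x
      using T[of x] by (simp add: T_op_def P_op_eq[of "K (P_op M u)"])
  qed
  have "u x = (\<integral>y. u y \<partial>M)" for x using P[of x] by (simp add: P_op_eq)
  then show "u \<in> {u \<in> L2 M. \<exists>c. AE x in M. u x = c}"
    using u unfolding AE_iff_all by blast
next
  fix u assume "u \<in> {u \<in> L2 M. \<exists>c. AE x in M. u x = c}"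
  then obtain c where u: "u \<in> L2 M" "u = (\<lambda>_. c)" by (auto simp: AE_iff_all)
  have "P_op M u = (\<lambda>_. 0)" unfolding u(2) by (simp add: P_op_eq prob_space)
  then have "K (P_op M u) = (\<lambda>_. 0)" by (simp add: K_op_def[abs_def])
  then have "T u = (\<lambda>_. 0)" by (simp add: T_op_def P_op_eq[of "\<lambda>_. 0"])
  then show "u \<in> L2_kernel M T" using u by (simp add: L2_kernel_def)
qed

end

theorem theorem7p2:
  fixes E :: "'a \<Rightarrow> 'a \<Rightarrow> bool"
  assumes "rado_graph E"
  shows "s_plus UNIV (graph_dist E) = \<infinity> \<and> s_minus UNIV (graph_dist E) = \<infinity> \<and>
    (\<forall>M :: 'a measure.
       prob_space M \<and> sets M = UNIV \<and> (\<forall>v. measure M {v} > 0) \<longrightarrow>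
         s_plus_op M (K_op (graph_dist E) M) = \<infinity> \<and>
         s_minus_op M (K_op (graph_dist E) M) = \<infinity> \<and>
         s_plus_op M (T_op (graph_dist E) M) = \<infinity> \<and>
         s_minus_op M (T_op (graph_dist E) M) = \<infinity> \<and>
         L2_kernel M (T_op (graph_dist E) M) = {u \<in> L2 M. \<exists>c. AE x in M. u x = c})"
proof (intro conjI allI impI; (elim conjE)?)
  show "s_plus UNIV (graph_dist E) = \<infinity>" "s_minus UNIV (graph_dist E) = \<infinity>"
    using assms by (rule s_plus_rado, rule s_minus_rado)
next
  fix M :: "'a measure"
  assume "prob_space M" "sets M = UNIV" "\<forall>v. measure M {v} > 0"
  then interpret prob_space M by simp
  interpret rado_measure M E
    by unfold_locales (use \<open>sets M = UNIV\<close> \<open>\<forall>v. measure M {v} > 0\<close> assms in \<open>auto simp: rado_graph_def\<close>)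
  show "s_plus_op M (K_op (graph_dist E) M) = \<infinity>" "s_minus_op M (K_op (graph_dist E) M) = \<infinity>"
    "s_plus_op M (T_op (graph_dist E) M) = \<infinity>" "s_minus_op M (T_op (graph_dist E) M) = \<infinity>"
    "L2_kernel M (T_op (graph_dist E) M) = {u \<in> L2 M. \<exists>c. AE x in M. u x = c}"
    by (rule infinite_signatures L2_kernel_T)+
qed

end
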